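(* Let $d\geq 1$ be an integer, put $\delta=2-\frac d2$, and let $\phi_d:\mathbb{R}^d\setminus\{0\}\to\mathbb{R}$ be the radial function $$\phi_d(x)=r^{2-d}\,e^{-r^2/2}\,Ei^{(\delta)}(r^2/2),\qquad r=\Vert x\Vert .$$ Then $\phi_d$ is an eigenfunction of the Fourier transform on $\mathbb{R}^d$ associated with the eigenvalue $-(2\pi)^{d/2}$, i.e. $$\widehat{\phi_d}=-(2\pi)^{d/2}\,\phi_d ,$$ where the Fourier transform $\widehat{\phi_d}$ is understood in the usual $L^1$ sense if $d=1$, in the Fourier-Plancherel ($L^2$) sense if $d=2,3$, and in the sense of tempered distributions if $d\geq 4$ (equality of functions being understood almost everywhere).
   Context: For a real number $\delta<2$ and $x>0$, the $\delta$-exponential function is $$Ei^{(\delta)}(x)=\int_{-\infty}^x\frac{e^t}{t^\delta}\,dt,$$ where, for $t<0$, $t^\delta$ means $-|t|^\delta$ (this convention is used for every $\delta<2$, including $\delta=0$ and negative $\delta$). For $\delta<1$ the integrand is integrable; for $1\leq\delta<2$ the integral is interpreted as the principal value $$Ei^{(\delta)}(x)=\lim_{\epsilon\to0^+}\left\{\int_{-\infty}^{-\epsilon}+\int_\epsilon^x\right\}\frac{e^t}{t^\delta}\,dt .$$ Fourier transform convention: for integrable $f:\mathbb{R}^d\to\mathbb{C}$, $\widehat f(t)=\int_{\mathbb{R}^d}e^{-i\langle t,x\rangle}f(x)\,dx$, with $\langle\cdot,\cdot\rangle$ the standard inner product and $dx$ Lebesgue measure. It is extended to $L^2(\mathbb{R}^d)$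 by density (Plancherel, with this unnormalized convention) and to tempered distributions by $\langle\widehat T,\varphi\rangle=\langle T,\widehat\varphi\rangle$ for $\varphi$ in the Schwartz space $\mathcal{S}(\mathbb{R}^d)$. A function $f$ with $f/(1+\Vert x\Vert^{2d})$ integrable is identified with the tempered distribution $\varphi\mapsto\int_{\mathbb{R}^d}f(x)\varphi(x)\,dx$. Here $\Vert x\Vert^2=x_1^2+\cdots+x_d^2$. The function $\phi_d$ is integrable for $d=1$, square integrable for $d=2,3$, and defines a tempered distribution for $d\geq4$. *)

theory Defs
  imports "HOL-Analysis.Analysis"
begin

definition signed_powr :: "real \<Rightarrow> real \<Rightarrow> real" where
  "signed_powr t \<delta> = sgn t * \<bar>t\<bar> powr \<delta>"

(* Meaningful for \<delta> < 2 and x > 0.  The integrand is divided by 0, hence 0, at the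
   single point t = 0. *)
definition Ei_delta :: "real \<Rightarrow> real \<Rightarrow> real" where
  "Ei_delta \<delta> x =
    (if \<delta> < 1 then (LINT t:{..x}|lborel. exp t / signed_powr t \<delta>)
     else Lim (at_right 0) (\<lambda>\<epsilon>.
            (LINT t:{..-\<epsilon>}|lborel. exp t / signed_powr t \<delta>) +
            (LINT t:{\<epsilon>..x}|lborel. exp t / signed_powr t \<delta>)))"

(* The value at the origin, where the formula is not meaningful, is irrelevant: all
   statements about this function are up to Lebesgue null sets. *)
definition phi :: "'a::euclidean_space \<Rightarrow> real" where
  "phi x = norm x powi (2 - int DIM('a)) * exp (- (norm x)\<^sup>2 / 2) *
           Ei_delta (2 - real DIM('a) / 2) ((norm x)\<^sup>2 / 2)"

definition fourier :: "('a::euclidean_space \<Rightarrow> complex) \<Rightarrow> 'a \<Rightarrow> complex" where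
  "fourier f t = (LINT x|lborel. exp (- \<i> * complex_of_real (t \<bullet> x)) * f x)"

definition fourier_L1 ::
    "('a::euclidean_space \<Rightarrow> complex) \<Rightarrow> ('a \<Rightarrow> complex) \<Rightarrow> bool" where
  "fourier_L1 f g \<longleftrightarrow> integrable lborel f \<and> (AE t in lborel. fourier f t = g t)"

definition square_integrable :: "('a::euclidean_space \<Rightarrow> complex) \<Rightarrow> bool" where
  "square_integrable f \<longleftrightarrow>
     f \<in> borel_measurable lborel \<and> integrable lborel (\<lambda>x. (cmod (f x))\<^sup>2)"

(* Extension by density: g is the L2 limit of the transforms of L1 \<inter> L2 functions
   converging to f in L2.  By Plancherel's theorem such a g exists for every square
   integrable f, and is unique almost everywhere and independent of the approximating
   sequence.  The distances are nonnegative integrals, so that an infinite distance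
   is not read as 0. *)
definition fourier_L2 ::
    "('a::euclidean_space \<Rightarrow> complex) \<Rightarrow> ('a \<Rightarrow> complex) \<Rightarrow> bool" where
  "fourier_L2 f g \<longleftrightarrow> square_integrable f \<and> square_integrable g \<and>
     (\<exists>F :: nat \<Rightarrow> 'a \<Rightarrow> complex.
        (\<forall>n. integrable lborel (F n) \<and> square_integrable (F n)) \<and>
        ((\<lambda>n. \<integral>\<^sup>+ x. ennreal ((cmod (F n x - f x))\<^sup>2) \<partial>lborel) \<longlonglongrightarrow> 0) \<and>
        ((\<lambda>n. \<integral>\<^sup>+ t. ennreal ((cmod (fourier (F n) t - g t))\<^sup>2) \<partial>lborel) \<longlonglongrightarrow> 0))"

(* Iterated partial derivatives along the directions in the list. *)
fun iter_partial ::
    "'a::euclidean_space list \<Rightarrow> ('a \<Rightarrow> complex) \<Rightarrow> 'a \<Rightarrow> complex" where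
  "iter_partial [] f = f"
| "iter_partial (b # bs) f = (\<lambda>x. frechet_derivative (iter_partial bs f) (at x) b)"

(* Differentiability of all iterated partial derivatives amounts to smoothness. *)
definition schwartz :: "('a::euclidean_space \<Rightarrow> complex) set" where
  "schwartz = {f. \<forall>bs \<in> lists Basis.
     (\<forall>x. iter_partial bs f differentiable (at x)) \<and>
     (\<forall>k::nat. \<exists>C. \<forall>x. norm x ^ k * cmod (iter_partial bs f x) \<le> C)}"

(* Sufficient for regular_distribution f, below, to be a tempered distribution. *)
definition tempered_function :: "('a::euclidean_space \<Rightarrow> complex) \<Rightarrow> bool" where
  "tempered_function f \<longleftrightarrow>
     integrable lborel (\<lambda>x. f x / complex_of_real (1 + norm x ^ (2 * DIM('a))))"

definition regular_distribution ::
    "('a::euclidean_space \<Rightarrow> complex) \<Rightarrow> ('a \<Rightarrow> complex) \<Rightarrow> complex" where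
  "regular_distribution f = (\<lambda>\<psi>. LINT x|lborel. f x * \<psi> x)"

definition fourier_distribution ::
    "(('a::euclidean_space \<Rightarrow> complex) \<Rightarrow> complex) \<Rightarrow> ('a \<Rightarrow> complex) \<Rightarrow> complex" where
  "fourier_distribution T = (\<lambda>\<psi>. T (fourier \<psi>))"

(* Distributions are represented by functionals on all functions, but only their
   values on the Schwartz space count. *)
definition fourier_tempered ::
    "('a::euclidean_space \<Rightarrow> complex) \<Rightarrow> ('a \<Rightarrow> complex) \<Rightarrow> bool" where
  "fourier_tempered f g \<longleftrightarrow> tempered_function f \<and> tempered_function g \<and>
     (\<forall>\<psi> \<in> schwartz.
        fourier_distribution (regular_distribution f) \<psi> = regular_distribution g \<psi>)"

end

theory Submission
  imports Defs "HOL-Probability.Characteristic_Functions" "HOL-Probability.Sinc_Integral"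
begin

text \<open>
  Write \<open>d\<close> for the dimension, \<open>D = d/2\<close> and \<open>r\<close> for the norm of \<open>x\<close>. The transform of the Gaussian
  \<open>exp (-v r\<^sup>2/2)\<close> is \<open>(2 pi)^D\<close> times \<open>v^(-D) exp (-r\<^sup>2/(2v))\<close>, and the transform of the latter function is
  \<open>(2 pi)^D\<close> times the former. Their difference
  \<open>K_v(x) = exp (-v r\<^sup>2/2) - v^(-D) exp (-r\<^sup>2/(2v))\<close>
  is therefore an eigenfunction for the eigenvalue \<open>-(2 pi)^D\<close> (\<open>fourier_gauss_diff\<close>), and the theorem
  says that \<open>phi\<close> is a superposition of these.

  Indeed, put \<open>y = r\<^sup>2/2\<close> in the definition of the exponential integral, and substitute
  \<open>t = y (1 - v)\<close> for positive \<open>t\<close> and \<open>t = y (1 - 1/v)\<close> for negative \<open>t\<close>, with \<open>v\<close> in the unit interval.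
  The two parts of the integral become the two terms of \<open>K_v\<close> and
  \<open>phi(x) = 2^(1-D) \<integral> (1 - v)^(D-2) K_v(x) dv\<close>, the integral being over \<open>0 < v < 1\<close>
  (\<open>Ei_delta_eq\<close>, \<open>phi_eq_gauss_mix\<close>). Since \<open>K_v\<close> vanishes to first order at \<open>v = 1\<close>, this integral
  converges absolutely for every \<open>d\<close>: combining the two terms takes care of the principal value.

  What remains is to interchange the transform with the integral over \<open>v\<close>, and there the only question is how
  \<open>K_v\<close> grows as \<open>v\<close> tends to 0. The basic estimate \<open>abs_gauss_diff_le\<close> bounds the \<open>L\<^sup>1\<close> norm of \<open>K_v\<close> by
  \<open>(1 - v) v^(-d/2)\<close> and its \<open>L\<^sup>2\<close> norm by \<open>(1 - v) v^(-d/4)\<close>, up to constants. The first is integrable against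
  the weight \<open>(1 - v)^(D-2)\<close> for \<open>d = 1\<close>, the second for \<open>d < 4\<close>. Hence for \<open>d = 1\<close> Fubini's theorem suffices
  (\<open>fourier_L1_phi\<close>). For \<open>d < 4\<close> the superpositions over \<open>1/(n+2) < v < 1\<close> are integrable, are exact
  eigenfunctions and converge to \<open>phi\<close> in \<open>L\<^sup>2\<close> (\<open>fourier_L2_phi\<close>). In every dimension the integral of \<open>K_v\<close> against a
  bounded integrable function is bounded by a multiple of \<open>1 - v\<close>, so that the pairing with such functions
  can be computed under the integral sign. The transform of a Schwartz function is of that kind
  (\<open>fourier_schwartz_decay\<close>), and the multiplication formula moves the transform onto \<open>K_v\<close>
  (\<open>fourier_tempered_phi\<close>).

  Finally \<open>phi\<close> is not zero almost everywhere because all \<open>K_v\<close> are positive where \<open>r\<^sup>2 > d\<close>.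
\<close>

section \<open>Fourier transform of Gaussians\<close>

lemma lebesgue_integral_lborel_prod:
  fixes F :: "'a::euclidean_space \<Rightarrow> real \<Rightarrow> complex"
  assumes int: "\<And>b. b \<in> Basis \<Longrightarrow> integrable lborel (F b)"
  shows "(LINT x|lborel. (\<Prod>b\<in>Basis. F b (x \<bullet> b))) = (\<Prod>b\<in>Basis. LINT s|lborel. F b s)"
proof -
  interpret product_sigma_finite "\<lambda>_::'a. lborel :: real measure" ..
  have [measurable]: "F b \<in> borel_measurable borel" if "b \<in> Basis" for b
    using int[OF that] by (simp add: borel_measurable_integrable)
  have "(LINT x|lborel. (\<Prod>b\<in>Basis. F b (x \<bullet> b)))
      = (LINT y|(\<Pi>\<^sub>M b\<in>Basis. lborel). (\<Prod>b\<in>Basis. F b ((\<Sum>b\<in>Basis. y b *\<^sub>R b) \<bullet> b)))"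
    by (subst lborel_eq, subst integral_distr) auto
  also have "\<dots> = (LINT y|(\<Pi>\<^sub>M b\<in>Basis. lborel). (\<Prod>b\<in>Basis. F b (y b)))"
    by (intro Bochner_Integration.integral_cong prod.cong refl) simp
  also have "\<dots> = (\<Prod>b\<in>Basis. LINT s|lborel. F b s)"
    by (rule product_integral_prod) (auto intro: int)
  finally show ?thesis .
qed

text \<open>
  A Gaussian is a product of functions of one coordinate, which reduces its integral and its transform to
  dimension one.
\<close>

lemma exp_norm_eq_prod:
  "exp (- a * (norm x)\<^sup>2 / 2) = (\<Prod>b\<in>Basis. exp (- a * (x \<bullet> b)\<^sup>2 / 2))"
  for x :: "'a::euclidean_space"
proof -
  have "(norm x)\<^sup>2 = (\<Sum>b\<in>Basis. (x \<bullet> b)\<^sup>2)"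
    unfolding power2_norm_eq_inner by (subst euclidean_inner) (simp add: power2_eq_square)
  then show ?thesis
    by (simp add: exp_sum[symmetric] sum_distrib_left sum_divide_distrib sum_negf)
qed

lemma gaussian_eq_normal_density:
  fixes a x :: real
  assumes "a > 0"
  shows "exp (- a * x\<^sup>2 / 2) = sqrt (2 * pi / a) * normal_density 0 (1 / sqrt a) x"
  using assms by (simp add: normal_density_def field_simps real_sqrt_divide real_sqrt_mult)

lemma nn_integral_gaussian_real:
  fixes a :: real
  assumes "a > 0"
  shows "(\<integral>\<^sup>+ x. ennreal (exp (- a * x\<^sup>2 / 2)) \<partial>lborel) = ennreal (sqrt (2 * pi / a))"
proof -
  have "integrable lborel (\<lambda>x. sqrt (2 * pi / a) * normal_density 0 (1 / sqrt a) x)"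
    using assms by (intro integrable_mult_right integrable_normal_density) auto
  then have "(\<integral>\<^sup>+ x. ennreal (exp (- a * x\<^sup>2 / 2)) \<partial>lborel) 
     = ennreal (LINT x|lborel. sqrt (2 * pi / a) * normal_density 0 (1 / sqrt a) x)"
    unfolding gaussian_eq_normal_density[OF assms]
    by (intro nn_integral_eq_integral) (use assms in auto)
  also have "(LINT x|lborel. sqrt (2 * pi / a) * normal_density 0 (1 / sqrt a) x) = sqrt (2 * pi / a)"
    using assms integral_normal_density[of "1 / sqrt a" 0] by simp
  finally show ?thesis .
qed

lemma nn_integral_gaussian:
  assumes "a > 0"
  shows "(\<integral>\<^sup>+ x. ennreal (exp (- a * (norm x)\<^sup>2 / 2)) \<partial>(lborel :: 'a::euclidean_space measure))
    = ennreal ((2 * pi / a) powr (real DIM('a) / 2))"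
proof -
  have "(\<integral>\<^sup>+ x. ennreal (exp (- a * (norm x)\<^sup>2 / 2)) \<partial>(lborel :: 'a measure))
     = (\<integral>\<^sup>+ x. (\<Prod>b\<in>Basis. ennreal (exp (- a * (x \<bullet> b)\<^sup>2 / 2))) \<partial>(lborel :: 'a measure))"
    by (subst exp_norm_eq_prod) (simp add: prod_ennreal)
  also have "\<dots> = (\<Prod>b\<in>(Basis::'a set). ennreal (sqrt (2 * pi / a)))"
    by (subst nn_integral_lborel_prod) (simp_all only: nn_integral_gaussian_real[OF assms], simp_all)
  also have "\<dots> = ennreal (sqrt (2 * pi / a) ^ DIM('a))"
    using assms by (simp add: ennreal_power)
  also have "sqrt (2 * pi / a) ^ DIM('a) = (2 * pi / a) powr (real DIM('a) / 2)"
    using assms by (simp add: powr_half_sqrt[symmetric] powr_realpow[symmetric] powr_powr)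
  finally show ?thesis .
qed

lemma integrable_gaussian:
  assumes "a > 0"
  shows "integrable lborel (\<lambda>x::'a::euclidean_space. exp (- a * (norm x)\<^sup>2 / 2))"
  by (rule integrableI_nonneg) (auto simp: nn_integral_gaussian[OF assms, simplified])

text \<open>
  The standard normal distribution is its own characteristic function up to a constant; the general
  width follows by scaling.
\<close>

lemma fourier_gaussian_real:
  fixes a t :: real
  assumes "a > 0"
  shows "(LINT s|lborel. exp (- \<i> * complex_of_real (t * s)) * complex_of_real (exp (- a * s\<^sup>2 / 2)))
    = complex_of_real (sqrt (2 * pi / a) * exp (- t\<^sup>2 / (2 * a)))"
proof -
  let ?c = "1 / sqrt a"
  let ?u = "- t * ?c"
  have [simp]: "0 < ?c" "(1 / sqrt a)\<^sup>2 = 1 / a" using assms by (auto simp: power_divide)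
  have "complex_of_real (exp (- t\<^sup>2 / (2 * a))) = char std_normal_distribution ?u"
    using assms by (subst char_std_normal_distribution) (simp add: power_divide field_simps)
  also have "\<dots> = (LINT s|lborel. std_normal_density s *\<^sub>R iexp (?u * s))"
    unfolding char_def by (subst integral_density) auto
  finally have *: "complex_of_real (exp (- t\<^sup>2 / (2 * a))) 
     = (LINT s|lborel. std_normal_density s *\<^sub>R iexp (?u * s))" .
  have "(LINT s|lborel. exp (- \<i> * complex_of_real (t * s)) * complex_of_real (exp (- a * s\<^sup>2 / 2)))
     = ?c *\<^sub>R (LINT s|lborel. exp (- \<i> * complex_of_real (t * (?c * s))) * complex_of_real (exp (- a * (?c * s)\<^sup>2 / 2)))"
    using lborel_integral_real_affine[of ?c "\<lambda>s. exp (- \<i> * complex_of_real (t * s)) * complex_of_real (exp (- a * s\<^sup>2 / 2))" 0] assms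
    by simp
  also have "(\<lambda>s. exp (- \<i> * complex_of_real (t * (?c * s))) * complex_of_real (exp (- a * (?c * s)\<^sup>2 / 2)))
     = (\<lambda>s. complex_of_real (sqrt (2 * pi)) * (std_normal_density s *\<^sub>R iexp (?u * s)))"
    using assms by (auto simp: fun_eq_iff std_normal_density_def scaleR_conv_of_real power_mult_distrib power_divide field_simps)
  also have "(LINT s|lborel. complex_of_real (sqrt (2 * pi)) * (std_normal_density s *\<^sub>R iexp (?u * s)))
     = complex_of_real (sqrt (2 * pi)) * complex_of_real (exp (- t\<^sup>2 / (2 * a)))"
    unfolding * by (rule integral_mult_right_zero)
  finally show ?thesis
    using assms by (simp add: scaleR_conv_of_real real_sqrt_divide)
qed

lemma fourier_gaussian:
  fixes t :: "'a::euclidean_space"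
  assumes "a > 0"
  shows "fourier (\<lambda>x. complex_of_real (exp (- a * (norm x)\<^sup>2 / 2))) t
    = complex_of_real ((2 * pi / a) powr (real DIM('a) / 2) * exp (- (norm t)\<^sup>2 / (2 * a)))"
proof -
  let ?F = "\<lambda>b s. exp (- \<i> * complex_of_real ((t \<bullet> b) * s)) * complex_of_real (exp (- a * s\<^sup>2 / 2))"
  have int: "integrable lborel (?F b)" for b
    using integrable_gaussian[OF assms, where 'a=real]
    by (rule Bochner_Integration.integrable_bound) (auto simp: norm_mult)
  have "fourier (\<lambda>x. complex_of_real (exp (- a * (norm x)\<^sup>2 / 2))) t = 
     (LINT x|lborel. (\<Prod>b\<in>Basis. ?F b (x \<bullet> b)))"
  proof -
    have "exp (- \<i> * complex_of_real (t \<bullet> x)) = (\<Prod>b\<in>Basis. exp (- \<i> * complex_of_real ((t \<bullet> b) * (x \<bullet> b))))"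
      for x :: 'a
      by (subst euclidean_inner) (simp add: exp_sum[symmetric] sum_distrib_left sum_negf)
    then show ?thesis
      unfolding fourier_def exp_norm_eq_prod by (simp only: prod.distrib of_real_prod)
  qed
  also have "\<dots> = (\<Prod>b\<in>Basis. complex_of_real (sqrt (2 * pi / a) * exp (- (t \<bullet> b)\<^sup>2 / (2 * a))))"
    by (subst lebesgue_integral_lborel_prod[OF int]) (simp only: fourier_gaussian_real[OF assms])
  also have "\<dots> = complex_of_real (sqrt (2 * pi / a) ^ DIM('a) * exp (- (norm t)\<^sup>2 / (2 * a)))"
    using exp_norm_eq_prod[of "1/a" t] by (simp add: prod.distrib mult.commute flip: of_real_prod)
  also have "sqrt (2 * pi / a) ^ DIM('a) = (2 * pi / a) powr (real DIM('a) / 2)"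
    using assms by (simp add: powr_half_sqrt[symmetric] powr_realpow[symmetric] powr_powr)
  finally show ?thesis .
qed

section \<open>Elementary eigenfunctions\<close>

text \<open>
  The function \<open>K_v\<close>: the Gaussian with parameter \<open>v\<close> minus its normalised transform.
\<close>

definition gauss_diff :: "real \<Rightarrow> 'a::euclidean_space \<Rightarrow> real" where
  "gauss_diff v x = exp (- v * (norm x)\<^sup>2 / 2)
     - v powr (- (real DIM('a) / 2)) * exp (- (norm x)\<^sup>2 / (2 * v))"

text \<open>
  The first term of the majorant has half the exponent of the first term of \<open>gauss_diff\<close>: the
  loss absorbs a polynomial factor in the estimate below, and costs only a constant in every integral over \<open>x\<close>.
\<close>

definition gauss_majorant :: "real \<Rightarrow> 'a::euclidean_space \<Rightarrow> real" where
  "gauss_majorant v x = exp (- v * (norm x)\<^sup>2 / 4)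
     + v powr (- (real DIM('a) / 2)) * exp (- (norm x)\<^sup>2 / (2 * v))"

lemma gauss_majorant_nonneg [simp]: "gauss_majorant v x \<ge> 0"
  by (simp add: gauss_majorant_def)

lemma measurable_gauss_diff [measurable]:
  "(\<lambda>(v, x). gauss_diff v x) \<in> borel_measurable (borel \<Otimes>\<^sub>M (borel :: 'a::euclidean_space measure))"
  unfolding gauss_diff_def by measurable

lemma measurable_gauss_majorant [measurable]:
  "(\<lambda>(v, x). gauss_majorant v x) \<in> borel_measurable (borel \<Otimes>\<^sub>M (borel :: 'a::euclidean_space measure))"
  unfolding gauss_majorant_def by measurable

lemma integrable_gauss_diff:
  assumes "v > 0"
  shows "integrable lborel (\<lambda>x::'a::euclidean_space. gauss_diff v x)"
  using integrable_gaussian[of v, where 'a='a] integrable_gaussian[of "1 / v", where 'a='a] assms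
  unfolding gauss_diff_def by (simp add: mult.commute)

text \<open>
  The transform exchanges the two terms, up to the factor \<open>(2 pi)^D\<close>, and so changes the sign of
  their difference.
\<close>

lemma fourier_gauss_diff:
  fixes t :: "'a::euclidean_space"
  assumes "v > 0"
  shows "fourier (\<lambda>x. complex_of_real (gauss_diff v x)) t
    = - complex_of_real ((2 * pi) powr (real DIM('a) / 2)) * complex_of_real (gauss_diff v t)"
proof -
  let ?D = "real DIM('a) / 2"
  let ?E = "\<lambda>a (x::'a). complex_of_real (exp (- a * (norm x)\<^sup>2 / 2))"
  have int: "integrable lborel (\<lambda>x. exp (- \<i> * complex_of_real (t \<bullet> x)) * ?E a x)" if "a > 0" for a
    using integrable_gaussian[OF that, where 'a='a]
    by (rule Bochner_Integration.integrable_bound) (auto simp: norm_mult)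
  have eq: "complex_of_real (gauss_diff v x)
      = ?E v x - complex_of_real (v powr (- ?D)) * ?E (1 / v) x" for x :: 'a
    by (simp add: gauss_diff_def)
  have "fourier (\<lambda>x. complex_of_real (gauss_diff v x)) t
      = fourier (?E v) t - complex_of_real (v powr (- ?D)) * fourier (?E (1 / v)) t"
  proof -
    have "exp (- \<i> * complex_of_real (t \<bullet> x)) * complex_of_real (gauss_diff v x)
        = exp (- \<i> * complex_of_real (t \<bullet> x)) * ?E v x
          - complex_of_real (v powr (- ?D)) * (exp (- \<i> * complex_of_real (t \<bullet> x)) * ?E (1 / v) x)" for x
      unfolding eq by (simp only: right_diff_distrib mult.left_commute)
    then show ?thesis
      unfolding fourier_def using int[of v] int[of "1 / v"] assms
      by (simp only: Bochner_Integration.integral_diff integrable_mult_right integral_mult_right_zero zero_less_divide_1_iff)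
  qed
  also have "\<dots> = complex_of_real ((2 * pi / v) powr ?D * exp (- (norm t)\<^sup>2 / (2 * v))
       - v powr (- ?D) * ((2 * pi * v) powr ?D * exp (- v * (norm t)\<^sup>2 / 2)))"
    using fourier_gaussian[of v t] fourier_gaussian[of "1 / v" t] assms by (simp add: mult.commute)
  also have "(2 * pi / v) powr ?D = (2 * pi) powr ?D * v powr (- ?D)"
    using assms by (simp add: powr_divide powr_minus_divide)
  also have "(2 * pi * v) powr ?D = (2 * pi) powr ?D * v powr ?D"
    using assms by (simp add: powr_mult)
  also have "(2 * pi) powr ?D * v powr (- ?D) * exp (- (norm t)\<^sup>2 / (2 * v))
       - v powr (- ?D) * ((2 * pi) powr ?D * v powr ?D * exp (- v * (norm t)\<^sup>2 / 2))
     = - ((2 * pi) powr ?D * gauss_diff v t)"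
  proof -
    have "v powr (- ?D) * v powr ?D = 1" using assms by (simp add: powr_add[symmetric])
    then show ?thesis unfolding gauss_diff_def by algebra
  qed
  finally show ?thesis by simp
qed

text \<open>
  The factor \<open>1 - v\<close> is what makes superpositions with the weight \<open>(1 - v)^(D-2)\<close> converge. For \<open>v\<close>
  bounded away from 1 it costs only a constant, and for \<open>v\<close> near 1 it comes from the difference of the exponents
  \<open>v\<close> and \<open>1/v\<close>.
\<close>

lemma exp_neg_diff_le:
  fixes v y :: real
  assumes v: "0 < v" "v < 1" and y: "y \<ge> 0"
  shows "0 \<le> exp (- v * y) - exp (- y / v)" 
    and "exp (- v * y) - exp (- y / v) \<le> 16 * (1 - v) * exp (- v * y / 2)"
proof -
  have vv: "v \<le> 1 / v" using v mult_le_one[of v v] by (simp add: le_divide_eq)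
  then have "v * y \<le> 1 / v * y" using y by (rule mult_right_mono)
  then show "0 \<le> exp (- v * y) - exp (- y / v)" by simp
  \<comment> \<open>The factor \<open>y\<close> that the second case produces is absorbed by giving up half of the exponent.\<close>
  show "exp (- v * y) - exp (- y / v) \<le> 16 * (1 - v) * exp (- v * y / 2)"
  proof (cases "v \<le> 1/2")
    case True
    have "exp (- v * y) - exp (- y / v) \<le> 1 * exp (- v * y / 2)"
    proof -
      have "exp (- v * y) \<le> exp (- v * y / 2)" using v y by simp
      then show ?thesis using exp_ge_zero[of "- y / v"] by linarith
    qed
    also have "\<dots> \<le> (16 * (1 - v)) * exp (- v * y / 2)"
      using True by (intro mult_right_mono) auto
    finally show ?thesis .
  next
    case False
    then have "1 \<le> 2 * v" by simp
    then have "1 * 1 \<le> (2 * v) * (2 * v)" by (intro mult_mono) auto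
    then have v4: "1 / v \<le> 4 * v" using v by (simp add: field_simps)
    have z: "(1 / v - v) * y \<le> 8 * (1 - v) * (v * y)"
    proof -
      have "1 / v - v = (1 - v) * (1 + v) * (1 / v)" using v by (simp add: field_simps)
      also have "\<dots> \<le> (1 - v) * 2 * (4 * v)"
        using v v4 by (intro mult_mono) auto
      finally have "(1 / v - v) * y \<le> (1 - v) * 2 * (4 * v) * y" using y by (rule mult_right_mono)
      then show ?thesis by (simp add: algebra_simps)
    qed
    have "exp (- v * y) - exp (- y / v) = exp (- v * y) * (1 - exp (- ((1 / v - v) * y)))"
      by (simp add: algebra_simps exp_add[symmetric])
    also have "\<dots> \<le> exp (- v * y) * ((1 / v - v) * y)"
      using exp_ge_add_one_self[of "- ((1 / v - v) * y)"] by (intro mult_left_mono) auto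
    also have "\<dots> \<le> exp (- v * y) * (8 * (1 - v) * (v * y))"
      using z by (intro mult_left_mono) auto
    also have "\<dots> = 16 * (1 - v) * (exp (- v * y) * (v * y / 2))"
      by simp
    also have "\<dots> \<le> 16 * (1 - v) * (exp (- v * y) * exp (v * y / 2))"
    proof -
      have "v * y / 2 \<le> exp (v * y / 2)" using exp_ge_add_one_self[of "v * y / 2"] by linarith
      then show ?thesis using v by (intro mult_left_mono[OF mult_left_mono]) auto
    qed
    also have "exp (- v * y) * exp (v * y / 2) = exp (- v * y / 2)"
      by (simp add: exp_add[symmetric])
    finally show ?thesis .
  qed
qed

lemma one_minus_powr_le:
  assumes v: "0 < v" "v < 1"
  shows "0 \<le> 1 - v powr (real n / 2)" "1 - v powr (real n / 2) \<le> real n * (1 - v)"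
proof -
  show "0 \<le> 1 - v powr (real n / 2)" using v by (simp add: powr_le1)
  \<comment> \<open>Doubling the exponent makes it a natural number, so that Bernoulli's inequality applies.\<close>
  have "1 + real n * (v - 1) \<le> (1 + (v - 1)) ^ n"
    using v by (intro Bernoulli_inequality) auto
  also have "\<dots> = v powr real n" using v by (simp add: powr_realpow)
  also have "\<dots> \<le> v powr (real n / 2)" using v by (intro powr_mono') auto
  finally show "1 - v powr (real n / 2) \<le> real n * (1 - v)" by (simp add: algebra_simps)
qed

text \<open>
  The difference of the exponentials and the deviation of \<open>v^(-D)\<close> from 1 are treated separately; each contributes
  one factor \<open>1 - v\<close>.
\<close>

lemma abs_gauss_diff_le:
  fixes x :: "'a::euclidean_space"
  assumes v: "0 < v" "v < 1"
  shows "\<bar>gauss_diff v x\<bar> \<le> (16 + real DIM('a)) * (1 - v) * gauss_majorant v x"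
proof -
  let ?D = "real DIM('a) / 2"
  define y where "y = (norm x)\<^sup>2 / 2"
  have y: "y \<ge> 0" by (simp add: y_def)
  define A where "A = exp (- v * y) - exp (- y / v)"
  define B where "B = v powr (- ?D) * (1 - v powr ?D) * exp (- y / v)"
  have eq: "gauss_diff v x = A - B"
  proof -
    have "v powr (- ?D) * v powr ?D = 1" using v by (simp add: powr_add[symmetric])
    then have "B = v powr (- ?D) * exp (- y / v) - exp (- y / v)"
      unfolding B_def by algebra
    then show ?thesis by (simp add: gauss_diff_def A_def y_def mult.commute)
  qed
  have A: "0 \<le> A" "A \<le> 16 * (1 - v) * exp (- v * y / 2)"
    using exp_neg_diff_le[OF v y] by (auto simp: A_def)
  have "0 \<le> B" 
    unfolding B_def using one_minus_powr_le[OF v] by (intro mult_nonneg_nonneg) auto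
  have "B \<le> v powr (- ?D) * (real DIM('a) * (1 - v)) * exp (- y / v)"
    unfolding B_def using one_minus_powr_le[OF v] by (intro mult_right_mono mult_left_mono) auto
  then have B: "B \<le> real DIM('a) * (1 - v) * (v powr (- ?D) * exp (- y / v))"
    by (simp add: mult_ac)
  have "\<bar>gauss_diff v x\<bar> \<le> A + B" using eq A \<open>0 \<le> B\<close> by linarith
  also have "\<dots> \<le> 16 * (1 - v) * exp (- v * y / 2)
      + real DIM('a) * (1 - v) * (v powr (- ?D) * exp (- y / v))"
    using A B by simp
  also have "\<dots> \<le> (16 + real DIM('a)) * (1 - v) * exp (- v * y / 2)
      + (16 + real DIM('a)) * (1 - v) * (v powr (- ?D) * exp (- y / v))"
    using v by (intro add_mono mult_right_mono) auto
  also have "\<dots> = (16 + real DIM('a)) * (1 - v) * gauss_majorant v x"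
    by (simp add: gauss_majorant_def y_def distrib_left)
  finally show ?thesis .
qed

lemma nn_integral_gauss_majorant_le:
  assumes v: "0 < v" "v < 1"
  shows "(\<integral>\<^sup>+ x. ennreal (gauss_majorant v x) \<partial>(lborel :: 'a::euclidean_space measure))
    \<le> ennreal (2 * (4 * pi) powr (real DIM('a) / 2) * v powr (- (real DIM('a) / 2)))"
proof -
  let ?D = "real DIM('a) / 2"
  have "(\<integral>\<^sup>+ x. ennreal (gauss_majorant v x) \<partial>(lborel :: 'a measure))
     = (\<integral>\<^sup>+ x. ennreal (exp (- (v / 2) * (norm x)\<^sup>2 / 2)) + ennreal (v powr - ?D) *
          ennreal (exp (- (1 / v) * (norm x)\<^sup>2 / 2)) \<partial>(lborel :: 'a measure))"
    by (intro nn_integral_cong)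
       (simp add: gauss_majorant_def ennreal_plus[symmetric] ennreal_mult'[symmetric] mult.commute del: ennreal_plus)
  also have "\<dots> = ennreal ((2 * pi / (v / 2)) powr ?D) + ennreal (v powr - ?D) * ennreal ((2 * pi / (1 / v)) powr ?D)"
    using v nn_integral_gaussian[of "v / 2", where 'a='a] nn_integral_gaussian[of "1 / v", where 'a='a]
    by (subst nn_integral_add, measurable) (simp add: nn_integral_cmult)
  also have "\<dots> = ennreal ((4 * pi / v) powr ?D + v powr - ?D * (2 * pi * v) powr ?D)"
    by (simp add: ennreal_mult' ennreal_plus)
  also have "\<dots> \<le> ennreal (2 * (4 * pi) powr ?D * v powr - ?D)"
  proof (rule ennreal_leI)
    have 1: "(4 * pi / v) powr ?D = (4 * pi) powr ?D * v powr - ?D"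
      using v by (simp add: powr_divide powr_minus_divide)
    have "v powr - ?D * (2 * pi * v) powr ?D \<le> v powr - ?D * (4 * pi) powr ?D"
      using v mult_left_mono[of v 2 "2 * pi"] by (intro mult_left_mono powr_mono2) auto
    then show "(4 * pi / v) powr ?D + v powr - ?D * (2 * pi * v) powr ?D \<le> 2 * (4 * pi) powr ?D * v powr - ?D"
      unfolding 1 by simp
  qed
  finally show ?thesis .
qed

lemma nn_integral_gauss_majorant_square_le:
  assumes v: "0 < v" "v < 1"
  shows "(\<integral>\<^sup>+ x. ennreal ((gauss_majorant v x)\<^sup>2) \<partial>(lborel :: 'a::euclidean_space measure))
    \<le> ennreal (4 * (2 * pi) powr (real DIM('a) / 2) * v powr (- (real DIM('a) / 2)))"
proof -
  let ?D = "real DIM('a) / 2"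
  have sq: "(gauss_majorant v x)\<^sup>2 \<le> 2 * exp (- v * (norm x)\<^sup>2 / 2) 
      + (2 * (v powr - ?D)\<^sup>2) * exp (- (2 / v) * (norm x)\<^sup>2 / 2)" for x :: 'a
  proof -
    have *: "(p + q)\<^sup>2 \<le> 2 * p\<^sup>2 + 2 * q\<^sup>2" for p q :: real
      using zero_le_power2[of "p - q"] by (simp add: power2_eq_square algebra_simps)
    have e1: "(exp (- v * (norm x)\<^sup>2 / 4))\<^sup>2 = exp (- v * (norm x)\<^sup>2 / 2)"
      and e2: "(exp (- (norm x)\<^sup>2 / (2 * v)))\<^sup>2 = exp (- (2 / v) * (norm x)\<^sup>2 / 2)"
      using v by (simp_all add: exp_double[symmetric] field_simps)
    show ?thesis
      unfolding gauss_majorant_def using *[of "exp (- v * (norm x)\<^sup>2 / 4)" "v powr - ?D * exp (- (norm x)\<^sup>2 / (2 * v))"]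
      by (simp only: power_mult_distrib e1 e2 mult.assoc)
  qed
  have "(\<integral>\<^sup>+ x. ennreal ((gauss_majorant v x)\<^sup>2) \<partial>(lborel :: 'a measure))
     \<le> (\<integral>\<^sup>+ x. ennreal 2 * ennreal (exp (- v * (norm x)\<^sup>2 / 2)) + ennreal (2 * (v powr - ?D)\<^sup>2) *
          ennreal (exp (- (2 / v) * (norm x)\<^sup>2 / 2)) \<partial>(lborel :: 'a measure))"
  proof (rule nn_integral_mono)
    fix x :: 'a
    show "ennreal ((gauss_majorant v x)\<^sup>2) \<le> ennreal 2 * ennreal (exp (- v * (norm x)\<^sup>2 / 2))
        + ennreal (2 * (v powr - ?D)\<^sup>2) * ennreal (exp (- (2 / v) * (norm x)\<^sup>2 / 2))"
      using ennreal_leI[OF sq[of x]] by (subst (asm) ennreal_plus) (simp_all add: ennreal_mult' mult.assoc)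
  qed
  also have "\<dots> = ennreal 2 * ennreal ((2 * pi / v) powr ?D) + ennreal (2 * (v powr - ?D)\<^sup>2) * ennreal ((2 * pi / (2 / v)) powr ?D)"
    using v nn_integral_gaussian[of "v", where 'a='a] nn_integral_gaussian[of "2 / v", where 'a='a]
    by (subst nn_integral_add, measurable) (simp add: nn_integral_cmult)
  also have "\<dots> = ennreal (2 * (2 * pi / v) powr ?D + 2 * (v powr - ?D)\<^sup>2 * (pi * v) powr ?D)"
    by (simp add: ennreal_mult' ennreal_plus)
  also have "\<dots> \<le> ennreal (4 * (2 * pi) powr ?D * v powr - ?D)"
  proof (rule ennreal_leI)
    have 1: "(2 * pi / v) powr ?D = (2 * pi) powr ?D * v powr - ?D"
      using v by (simp add: powr_divide powr_minus_divide)
    have 2: "(v powr - ?D)\<^sup>2 * (pi * v) powr ?D = pi powr ?D * v powr - ?D"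
    proof -
      have "v powr (- ?D) * v powr ?D = 1" using v by (simp add: powr_add[symmetric])
      moreover have "(pi * v) powr ?D = pi powr ?D * v powr ?D" using v by (simp add: powr_mult)
      ultimately show ?thesis by algebra
    qed
    have "pi powr ?D * v powr - ?D \<le> (2 * pi) powr ?D * v powr - ?D"
      by (intro mult_right_mono powr_mono2) auto
    then show "2 * (2 * pi / v) powr ?D + 2 * (v powr - ?D)\<^sup>2 * (pi * v) powr ?D \<le> 4 * (2 * pi) powr ?D * v powr - ?D"
      unfolding 1 using 2 by (simp add: mult.assoc mult.commute[of _ "v powr - ?D"])
  qed
  finally show ?thesis .
qed

text \<open>
  Against a bounded integrable \<open>h\<close> the majorant does not blow up as \<open>v\<close> tends to 0: its first term is at
  most 1, so that integrability of \<open>h\<close> suffices, and its second term has an integral independent of \<open>v\<close>, so that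
  boundedness of \<open>h\<close> suffices.
\<close>

lemma nn_integral_gauss_majorant_bounded_le:
  fixes h :: "'a::euclidean_space \<Rightarrow> complex"
  assumes v: "0 < v" "v < 1" and h: "integrable lborel h" and B: "\<And>x. cmod (h x) \<le> B"
  shows "(\<integral>\<^sup>+ x. ennreal (gauss_majorant v x * cmod (h x)) \<partial>lborel)
    \<le> ennreal ((LINT x|lborel. cmod (h x)) + B * (2 * pi) powr (real DIM('a) / 2))"
proof -
  let ?D = "real DIM('a) / 2"
  have [measurable]: "h \<in> borel_measurable borel" using h by (simp add: borel_measurable_integrable)
  have "B \<ge> 0" using B[of 0] norm_ge_zero order_trans by blast
  have "gauss_majorant v x * cmod (h x) \<le> cmod (h x) + B * v powr - ?D * exp (- (1 / v) * (norm x)\<^sup>2 / 2)" for x :: 'a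
  proof -
    have "gauss_majorant v x * cmod (h x) = exp (- v * (norm x)\<^sup>2 / 4) * cmod (h x)
       + cmod (h x) * (v powr - ?D * exp (- (1 / v) * (norm x)\<^sup>2 / 2))"
      by (simp add: gauss_majorant_def algebra_simps)
    also have "\<dots> \<le> 1 * cmod (h x) + B * (v powr - ?D * exp (- (1 / v) * (norm x)\<^sup>2 / 2))"
      using v B by (intro add_mono mult_right_mono) auto
    finally show ?thesis by simp
  qed
  then have "(\<integral>\<^sup>+ x. ennreal (gauss_majorant v x * cmod (h x)) \<partial>lborel)
     \<le> (\<integral>\<^sup>+ x. ennreal (cmod (h x)) + ennreal (B * v powr - ?D) * ennreal (exp (- (1 / v) * (norm x)\<^sup>2 / 2)) \<partial>lborel)"
    using \<open>B \<ge> 0\<close> by (intro nn_integral_mono) (simp add: ennreal_plus[symmetric] ennreal_mult'[symmetric] del: ennreal_plus)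
  also have "\<dots> = ennreal (LINT x|lborel. cmod (h x)) + ennreal (B * v powr - ?D) * ennreal ((2 * pi / (1 / v)) powr ?D)"
    using v nn_integral_gaussian[of "1 / v", where 'a='a] h
    by (subst nn_integral_add, measurable) (simp add: nn_integral_cmult nn_integral_eq_integral)
  also have "(2 * pi / (1 / v)) powr ?D = (2 * pi) powr ?D * v powr ?D"
    using v by (simp add: powr_mult)
  also have "ennreal (B * v powr - ?D) * ennreal ((2 * pi) powr ?D * v powr ?D) = ennreal (B * (2 * pi) powr ?D)"
  proof -
    have "v powr (- ?D) * v powr ?D = 1" using v by (simp add: powr_add[symmetric])
    then have "B * v powr - ?D * ((2 * pi) powr ?D * v powr ?D) = B * (2 * pi) powr ?D"
      by algebra
    then show ?thesis using \<open>B \<ge> 0\<close> by (simp add: ennreal_mult'[symmetric])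
  qed
  finally show ?thesis using \<open>B \<ge> 0\<close> by (simp add: ennreal_plus)
qed

section \<open>Superpositions of elementary eigenfunctions\<close>

text \<open>
  The set \<open>S\<close> of parameters allows truncations of the full superposition over the unit interval.
\<close>

definition gauss_mix :: "real set \<Rightarrow> 'a::euclidean_space \<Rightarrow> real" where
  "gauss_mix S x = (LINT v:S|lborel. (1 - v) powr (real DIM('a) / 2 - 2) * gauss_diff v x)"

lemma nn_integral_Beta_finite:
  assumes "a > 0" "b > (0::real)" "S \<subseteq> {0<..<1}"
  shows "(\<integral>\<^sup>+ v. indicator S v * ennreal ((1 - v) powr (b - 1) * v powr (a - 1)) \<partial>lborel) < \<infinity>"
proof -
  have "(\<integral>\<^sup>+ v. indicator S v * ennreal ((1 - v) powr (b - 1) * v powr (a - 1)) \<partial>lborel)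
     \<le> (\<integral>\<^sup>+ v. ennreal (norm (indicator {0..1} v *\<^sub>R (v powr (a - 1) * (1 - v) powr (b - 1)))) \<partial>lborel)"
    using assms(3) by (intro nn_integral_mono) (auto simp: indicator_def mult.commute)
  also have "\<dots> < \<infinity>"
    using integrable_Beta[OF assms(1,2)] unfolding set_integrable_def integrable_iff_bounded by blast
  finally show ?thesis .
qed

text \<open>
  One factor \<open>1 - v\<close> from the estimate of \<open>gauss_diff\<close> raises the exponent of the weight from
  \<open>D - 2\<close> to \<open>D - 1\<close>, which is integrable at \<open>v = 1\<close>.
\<close>

lemma weighted_gauss_diff_le:
  fixes x :: "'a::euclidean_space"
  assumes "S \<subseteq> {0<..<1}"
  shows "\<bar>indicator S v * (1 - v) powr (real DIM('a) / 2 - 2) * gauss_diff v x\<bar>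
    \<le> (16 + real DIM('a)) * (indicator S v * ((1 - v) powr (real DIM('a) / 2 - 1) * gauss_majorant v x))"
proof (cases "v \<in> S")
  case True
  then have v: "0 < v" "v < 1" using assms by auto
  let ?w = "(1 - v) powr (real DIM('a) / 2 - 2)"
  have "\<bar>?w * gauss_diff v x\<bar> = ?w * \<bar>gauss_diff v x\<bar>" by (simp add: abs_mult)
  also have "\<dots> \<le> ?w * ((16 + real DIM('a)) * (1 - v) * gauss_majorant v x)"
    using abs_gauss_diff_le[OF v, of x] by (intro mult_left_mono) auto
  also have "?w * ((16 + real DIM('a)) * (1 - v) * gauss_majorant v x) =
     (16 + real DIM('a)) * ((?w * (1 - v)) * gauss_majorant v x)" by simp
  also have "?w * (1 - v) = (1 - v) powr (real DIM('a) / 2 - 1)"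
    using v powr_add[of "1 - v" "real DIM('a) / 2 - 2" 1] by simp
  finally show ?thesis using True by simp
qed simp

lemma ennreal_weighted_gauss_diff_le:
  fixes x :: "'a::euclidean_space"
  assumes "S \<subseteq> {0<..<1}"
  shows "ennreal \<bar>indicator S v * (1 - v) powr (real DIM('a) / 2 - 2) * gauss_diff v x\<bar>
    \<le> ennreal (16 + real DIM('a)) * 
       (indicator S v * ennreal ((1 - v) powr (real DIM('a) / 2 - 1)) * ennreal (gauss_majorant v x))"
  using ennreal_leI[OF weighted_gauss_diff_le[OF assms, of v x]]
  by (simp add: ennreal_mult' mult.assoc ennreal_indicator del: ennreal_plus)

text \<open>
  Every later integral of a superposition against a function \<open>h\<close> is computed by this interchange: \<open>h\<close> is a
  character, the weight of a tempered function, a Schwartz function or the transform of one.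
\<close>

lemma gauss_mix_Fubini:
  fixes h :: "'a::euclidean_space \<Rightarrow> complex"
  assumes S [measurable]: "S \<in> sets borel" and S01: "S \<subseteq> {0<..<1}"
    and h [measurable]: "h \<in> borel_measurable borel"
    and fin: "(\<integral>\<^sup>+ v. indicator S v * ennreal ((1 - v) powr (real DIM('a) / 2 - 1)) *
        (\<integral>\<^sup>+ x. ennreal (gauss_majorant v x * cmod (h x)) \<partial>lborel) \<partial>lborel) < \<infinity>"
  shows "integrable lborel (\<lambda>x. complex_of_real (gauss_mix S x) * h x)"
    and "(LINT x|lborel. complex_of_real (gauss_mix S x) * h x) =
      (LINT v|lborel. complex_of_real (indicator S v * (1 - v) powr (real DIM('a) / 2 - 2)) *
         (LINT x|lborel. complex_of_real (gauss_diff v x) * h x))"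
proof -
  let ?D = "real DIM('a) / 2"
  let ?a = "\<lambda>v. indicator S v * (1 - v) powr (?D - 2)"
  let ?F = "\<lambda>v x. complex_of_real (?a v * gauss_diff v x) * h x"
  let ?C = "ennreal (16 + real DIM('a))"
  have int: "integrable (lborel \<Otimes>\<^sub>M lborel) (case_prod ?F)"
  proof (rule integrableI_bounded)
    show "case_prod ?F \<in> borel_measurable (lborel \<Otimes>\<^sub>M lborel)" by measurable
    have "(\<integral>\<^sup>+ p. ennreal (norm (case_prod ?F p)) \<partial>(lborel \<Otimes>\<^sub>M lborel))
       = (\<integral>\<^sup>+ v. \<integral>\<^sup>+ x. ennreal (norm (?F v x)) \<partial>lborel \<partial>lborel)"
      by (subst lborel.nn_integral_fst[symmetric]) auto
    also have "\<dots> \<le> (\<integral>\<^sup>+ v. \<integral>\<^sup>+ x. ?C * (indicator S v * ennreal ((1 - v) powr (?D - 1))) *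
        ennreal (gauss_majorant v x * cmod (h x)) \<partial>lborel \<partial>lborel)"
    proof (intro nn_integral_mono)
      fix v :: real and x :: 'a
      have "ennreal (norm (?F v x)) = ennreal \<bar>?a v * gauss_diff v x\<bar> * ennreal (cmod (h x))"
        by (simp add: norm_mult ennreal_mult' abs_mult)
      also have "\<dots> \<le> (?C * (indicator S v * ennreal ((1 - v) powr (?D - 1)) * ennreal (gauss_majorant v x))) * ennreal (cmod (h x))"
        by (intro mult_right_mono ennreal_weighted_gauss_diff_le S01) auto
      finally show "ennreal (norm (?F v x)) \<le> ?C * (indicator S v * ennreal ((1 - v) powr (?D - 1))) *
        ennreal (gauss_majorant v x * cmod (h x))"
        by (simp add: ennreal_mult' mult.assoc)
    qed
    also have "\<dots> = ?C * (\<integral>\<^sup>+ v. indicator S v * ennreal ((1 - v) powr (?D - 1)) *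
        (\<integral>\<^sup>+ x. ennreal (gauss_majorant v x * cmod (h x)) \<partial>lborel) \<partial>lborel)"
      by (simp add: nn_integral_cmult mult.assoc)
    also have "\<dots> < \<infinity>" using fin by (simp add: ennreal_mult_less_top)
    finally show "(\<integral>\<^sup>+ p. ennreal (norm (case_prod ?F p)) \<partial>(lborel \<Otimes>\<^sub>M lborel)) < \<infinity>" .
  qed
  have mix: "(LINT v|lborel. ?F v x) = complex_of_real (gauss_mix S x) * h x" for x
    by (simp add: gauss_mix_def set_lebesgue_integral_def mult.assoc del: of_real_mult)
  show "integrable lborel (\<lambda>x. complex_of_real (gauss_mix S x) * h x)"
    using lborel_pair.integrable_snd[OF int] unfolding mix .
  have "(LINT x|lborel. complex_of_real (gauss_mix S x) * h x) = (LINT v|lborel. LINT x|lborel. ?F v x)"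
    using lborel_pair.Fubini_integral[OF int] unfolding mix .
  also have "\<dots> = (LINT v|lborel. complex_of_real (?a v) * (LINT x|lborel. complex_of_real (gauss_diff v x) * h x))"
    by (simp add: mult.assoc)
  finally show "(LINT x|lborel. complex_of_real (gauss_mix S x) * h x) =
      (LINT v|lborel. complex_of_real (?a v) * (LINT x|lborel. complex_of_real (gauss_diff v x) * h x))" .
qed

text \<open>
  The hypothesis is the integrability over \<open>S\<close> of the bound for the \<open>L\<^sup>1\<close> norm of \<open>gauss_diff v\<close>. Under it, a superposition of
  eigenfunctions is an eigenfunction at every point \<open>t\<close>.
\<close>

lemma fourier_gauss_mix:
  fixes t :: "'a::euclidean_space"
  assumes S [measurable]: "S \<in> sets borel" and S01: "S \<subseteq> {0<..<1}"
    and fin: "(\<integral>\<^sup>+ v. indicator S v * ennreal ((1 - v) powr (real DIM('a) / 2 - 1) *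
        v powr (- (real DIM('a) / 2))) \<partial>lborel) < \<infinity>"
  shows "integrable lborel (\<lambda>x::'a. complex_of_real (gauss_mix S x))"
    and "fourier (\<lambda>x. complex_of_real (gauss_mix S x)) t
      = - complex_of_real ((2 * pi) powr (real DIM('a) / 2)) * complex_of_real (gauss_mix S t)"
proof -
  let ?D = "real DIM('a) / 2"
  let ?L = "complex_of_real ((2 * pi) powr ?D)"
  have finh: "(\<integral>\<^sup>+ v. indicator S v * ennreal ((1 - v) powr (?D - 1)) *
        (\<integral>\<^sup>+ x. ennreal (gauss_majorant v x * cmod (h x)) \<partial>lborel) \<partial>lborel) < \<infinity>"
    if h: "\<And>x. cmod (h x) = 1" for h :: "'a \<Rightarrow> complex"
  proof -
    have "(\<integral>\<^sup>+ v. indicator S v * ennreal ((1 - v) powr (?D - 1)) *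
        (\<integral>\<^sup>+ x. ennreal (gauss_majorant v x * cmod (h x)) \<partial>lborel) \<partial>lborel)
      \<le> (\<integral>\<^sup>+ v. ennreal (2 * (4 * pi) powr ?D) * (indicator S v * ennreal ((1 - v) powr (?D - 1) * v powr (- ?D))) \<partial>lborel)"
    proof (rule nn_integral_mono)
      fix v :: real
      show "indicator S v * ennreal ((1 - v) powr (?D - 1)) *
          (\<integral>\<^sup>+ x. ennreal (gauss_majorant v x * cmod (h x)) \<partial>lborel)
        \<le> ennreal (2 * (4 * pi) powr ?D) * (indicator S v * ennreal ((1 - v) powr (?D - 1) * v powr (- ?D)))"
      proof (cases "v \<in> S")
        case True
        then have v: "0 < v" "v < 1" using S01 by auto
        have "ennreal ((1 - v) powr (?D - 1)) * (\<integral>\<^sup>+ x. ennreal (gauss_majorant v x) \<partial>(lborel :: 'a measure))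
          \<le> ennreal ((1 - v) powr (?D - 1)) * ennreal (2 * (4 * pi) powr ?D * v powr (- ?D))"
          by (intro mult_left_mono nn_integral_gauss_majorant_le v) auto
        also have "\<dots> = ennreal (2 * (4 * pi) powr ?D) * ennreal ((1 - v) powr (?D - 1) * v powr (- ?D))"
          by (simp add: ennreal_mult'[symmetric] mult_ac)
        finally show ?thesis using True by (simp add: h)
      qed simp
    qed
    also have "\<dots> = ennreal (2 * (4 * pi) powr ?D) * (\<integral>\<^sup>+ v. indicator S v * ennreal ((1 - v) powr (?D - 1) * v powr (- ?D)) \<partial>lborel)"
      by (rule nn_integral_cmult) measurable
    also have "\<dots> < \<infinity>" using fin by (simp add: ennreal_mult_less_top)
    finally show ?thesis .
  qed
  show "integrable lborel (\<lambda>x::'a. complex_of_real (gauss_mix S x))"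
    using gauss_mix_Fubini(1)[OF S S01 _ finh, of "\<lambda>_. 1"] by simp
  let ?e = "\<lambda>x. exp (- \<i> * complex_of_real (t \<bullet> x))"
  have "fourier (\<lambda>x. complex_of_real (gauss_mix S x)) t = (LINT x|lborel. complex_of_real (gauss_mix S x) * ?e x)"
    by (simp add: fourier_def mult.commute)
  also have "\<dots> = (LINT v|lborel. complex_of_real (indicator S v * (1 - v) powr (?D - 2)) *
         (LINT x|lborel. complex_of_real (gauss_diff v x) * ?e x))"
    by (rule gauss_mix_Fubini(2)[OF S S01 _ finh]) auto
  also have "\<dots> = (LINT v|lborel. - ?L * complex_of_real (indicator S v * (1 - v) powr (?D - 2) * gauss_diff v t))"
  proof (rule Bochner_Integration.integral_cong[OF refl])
    fix v :: real
    show "complex_of_real (indicator S v * (1 - v) powr (?D - 2)) * (LINT x|lborel. complex_of_real (gauss_diff v x) * ?e x)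
      = - ?L * complex_of_real (indicator S v * (1 - v) powr (?D - 2) * gauss_diff v t)"
    proof (cases "v \<in> S")
      case True
      then have "v > 0" using S01 by auto
      then show ?thesis using fourier_gauss_diff[of v t] by (simp add: fourier_def mult.commute)
    qed simp
  qed
  also have "\<dots> = - ?L * complex_of_real (gauss_mix S t)"
    by (simp only: integral_mult_right_zero integral_complex_of_real gauss_mix_def set_lebesgue_integral_def real_scaleR_def mult.assoc)
  finally show "fourier (\<lambda>x. complex_of_real (gauss_mix S x)) t = - ?L * complex_of_real (gauss_mix S t)" .
qed

lemma ennreal_abs_gauss_mix_le:
  fixes x :: "'a::euclidean_space"
  assumes [measurable]: "S \<in> sets borel" and S01: "S \<subseteq> {0<..<1}"
  shows "ennreal \<bar>gauss_mix S x\<bar> \<le> ennreal (16 + real DIM('a)) *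
    (\<integral>\<^sup>+ v. indicator S v * ennreal ((1 - v) powr (real DIM('a) / 2 - 1)) * ennreal (gauss_majorant v x) \<partial>lborel)"
proof -
  let ?D = "real DIM('a) / 2"
  let ?f = "\<lambda>v. indicator S v * (1 - v) powr (?D - 2) * gauss_diff v x"
  have mix: "gauss_mix S x = (LINT v|lborel. ?f v)"
    by (simp add: gauss_mix_def set_lebesgue_integral_def mult.assoc)
  have "ennreal \<bar>gauss_mix S x\<bar> \<le> (\<integral>\<^sup>+ v. ennreal \<bar>?f v\<bar> \<partial>lborel)"
    unfolding mix using integral_norm_bound_ennreal[of lborel ?f]
    by (cases "integrable lborel ?f") (auto simp: not_integrable_integral_eq)
  also have "\<dots> \<le> (\<integral>\<^sup>+ v. ennreal (16 + real DIM('a)) * (indicator S v * ennreal ((1 - v) powr (?D - 1)) * ennreal (gauss_majorant v x)) \<partial>lborel)"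
    by (intro nn_integral_mono ennreal_weighted_gauss_diff_le S01)
  also have "\<dots> = ennreal (16 + real DIM('a)) *
    (\<integral>\<^sup>+ v. indicator S v * ennreal ((1 - v) powr (?D - 1)) * ennreal (gauss_majorant v x) \<partial>lborel)"
    by (rule nn_integral_cmult) measurable
  finally show ?thesis .
qed

lemma measurable_gauss_mix [measurable]:
  assumes [measurable]: "S \<in> sets borel"
  shows "gauss_mix S \<in> borel_measurable (borel :: 'a::euclidean_space measure)"
  unfolding gauss_mix_def set_lebesgue_integral_def by measurable

text \<open>
  This is Minkowski's inequality for integrals, with the bound \<open>v^(-d/4)\<close> in place of the \<open>L\<^sup>2\<close> norm of
  the majorant. It follows from the Cauchy-Schwarz inequality in \<open>v\<close>, after the integrand is split with the
  weight \<open>v^(-d/8)\<close> on one factor and its inverse on the other. After integration over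
  \<open>x\<close> the two factors agree up to a constant.
\<close>

lemma nn_integral_gauss_mix_square_le:
  assumes [measurable]: "S \<in> sets borel" and S01: "S \<subseteq> {0<..<1}"
  shows "(\<integral>\<^sup>+ x. ennreal ((gauss_mix S x)\<^sup>2) \<partial>(lborel :: 'a::euclidean_space measure))
    \<le> ennreal ((16 + real DIM('a))\<^sup>2 * (4 * (2 * pi) powr (real DIM('a) / 2))) *
      (\<integral>\<^sup>+ v. indicator S v * ennreal ((1 - v) powr (real DIM('a) / 2 - 1) * v powr (- (real DIM('a) / 4))) \<partial>lborel)\<^sup>2"
proof -
  let ?D = "real DIM('a) / 2" and ?Q = "real DIM('a) / 4"
  let ?C = "16 + real DIM('a)"
  let ?w = "\<lambda>v. (1 - v) powr (?D - 1)"
  let ?I = "\<integral>\<^sup>+ v. indicator S v * ennreal (?w v * v powr (- ?Q)) \<partial>lborel"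
  let ?f = "\<lambda>v. indicator S v * ennreal (sqrt (?w v * v powr (- ?Q)))"
  let ?g = "\<lambda>(x::'a) v. indicator S v * ennreal (sqrt (?w v * v powr ?Q) * gauss_majorant v x)"
  have ind2: "(indicator S v)\<^sup>2 = (indicator S v :: ennreal)" for v
    by (auto simp: indicator_def)
  have sq: "(sqrt (?w v * v powr r))\<^sup>2 = ?w v * v powr r" for v r by simp
  have f2: "?f v ^ 2 = indicator S v * ennreal (?w v * v powr (- ?Q))" for v
    by (simp add: power_mult_distrib ind2 ennreal_power sq)
  have g2: "?g x v ^ 2 = indicator S v * ennreal (?w v * v powr ?Q) * ennreal ((gauss_majorant v x)\<^sup>2)" for x v
    by (simp add: power_mult_distrib ind2 ennreal_power sq ennreal_mult' mult.assoc)
  have fg: "indicator S v * ennreal (?w v) * ennreal (gauss_majorant v x) = ?f v * ?g x v" for x v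
  proof (cases "v \<in> S")
    case True
    then have v: "0 < v" "v < 1" using S01 by auto
    have "v powr (- ?Q) * v powr ?Q = 1" using v by (simp add: powr_add[symmetric])
    then have "(?w v * v powr (- ?Q)) * (?w v * v powr ?Q) = (?w v)\<^sup>2" by algebra
    then have "sqrt (?w v * v powr (- ?Q)) * sqrt (?w v * v powr ?Q) = sqrt ((?w v)\<^sup>2)"
      by (simp only: real_sqrt_mult[symmetric])
    then have "sqrt (?w v * v powr (- ?Q)) * sqrt (?w v * v powr ?Q) = ?w v" by simp
    then show ?thesis using True by (simp add: ennreal_mult'[symmetric] mult.assoc[symmetric])
  qed simp
  have pt: "ennreal ((gauss_mix S x)\<^sup>2) \<le> ennreal (?C\<^sup>2) * (?I * (\<integral>\<^sup>+ v. ?g x v ^ 2 \<partial>lborel))" for x :: 'a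
  proof -
    have "ennreal ((gauss_mix S x)\<^sup>2) = (ennreal \<bar>gauss_mix S x\<bar>)\<^sup>2"
      by (simp add: ennreal_power)
    also have "\<dots> \<le> (ennreal ?C * (\<integral>\<^sup>+ v. ?f v * ?g x v \<partial>lborel))\<^sup>2"
      using ennreal_abs_gauss_mix_le[OF assms, of x] unfolding fg by (rule power_mono) simp
    also have "\<dots> = ennreal (?C\<^sup>2) * (\<integral>\<^sup>+ v. ?f v * ?g x v \<partial>lborel)\<^sup>2"
      by (simp add: power_mult_distrib ennreal_power del: ennreal_plus)
    also have "\<dots> \<le> ennreal (?C\<^sup>2) * ((\<integral>\<^sup>+ v. ?f v ^ 2 \<partial>lborel) * (\<integral>\<^sup>+ v. ?g x v ^ 2 \<partial>lborel))"
      by (intro mult_left_mono Cauchy_Schwarz_nn_integral) auto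
    finally show ?thesis unfolding f2 .
  qed
  have gm [measurable]: "(\<lambda>(v, x). ?g x v ^ 2) \<in> borel_measurable (lborel \<Otimes>\<^sub>M lborel)"
    unfolding g2 by measurable
  have "(\<integral>\<^sup>+ x. ennreal ((gauss_mix S x)\<^sup>2) \<partial>(lborel :: 'a measure))
     \<le> (\<integral>\<^sup>+ x. (ennreal (?C\<^sup>2) * ?I) * (\<integral>\<^sup>+ v. ?g x v ^ 2 \<partial>lborel) \<partial>lborel)"
    using pt by (intro nn_integral_mono) (simp add: mult.assoc)
  also have "\<dots> = (ennreal (?C\<^sup>2) * ?I) * (\<integral>\<^sup>+ x. \<integral>\<^sup>+ v. ?g x v ^ 2 \<partial>lborel \<partial>lborel)"
    by (rule nn_integral_cmult) measurable
  also have "\<dots> = (ennreal (?C\<^sup>2) * ?I) * (\<integral>\<^sup>+ v. \<integral>\<^sup>+ x. ?g x v ^ 2 \<partial>lborel \<partial>lborel)"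
    using lborel_pair.Fubini'[OF gm] by simp
  also have "\<dots> \<le> (ennreal (?C\<^sup>2) * ?I) * (\<integral>\<^sup>+ v. ennreal (4 * (2 * pi) powr ?D) * (indicator S v * ennreal (?w v * v powr (- ?Q))) \<partial>lborel)"
  proof (intro mult_left_mono nn_integral_mono)
    fix v :: real
    show "(\<integral>\<^sup>+ x. ?g x v ^ 2 \<partial>lborel) \<le> ennreal (4 * (2 * pi) powr ?D) * (indicator S v * ennreal (?w v * v powr (- ?Q)))"
    proof (cases "v \<in> S")
      case True
      then have v: "0 < v" "v < 1" using S01 by auto
      have "(\<integral>\<^sup>+ x. ?g x v ^ 2 \<partial>lborel) = ennreal (?w v * v powr ?Q) * (\<integral>\<^sup>+ x. ennreal ((gauss_majorant v x)\<^sup>2) \<partial>(lborel :: 'a measure))"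
        unfolding g2 using True by (simp add: nn_integral_cmult)
      also have "\<dots> \<le> ennreal (?w v * v powr ?Q) * ennreal (4 * (2 * pi) powr ?D * v powr (- ?D))"
        by (intro mult_left_mono nn_integral_gauss_majorant_square_le v) auto
      also have "\<dots> = ennreal (4 * (2 * pi) powr ?D) * ennreal (?w v * (v powr ?Q * v powr (- ?D)))"
        by (simp add: ennreal_mult'[symmetric] mult_ac)
      also have "v powr ?Q * v powr (- ?D) = v powr (- ?Q)" by (simp add: powr_add[symmetric])
      finally show ?thesis using True by simp
    qed (simp add: g2)
  qed simp
  also have "\<dots> = (ennreal (?C\<^sup>2) * ?I) * (ennreal (4 * (2 * pi) powr ?D) * ?I)"
    by (subst nn_integral_cmult) simp_all
  also have "ennreal (?C\<^sup>2) * ?I * (ennreal (4 * (2 * pi) powr ?D) * ?I) =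
     ennreal (?C\<^sup>2 * (4 * (2 * pi) powr ?D)) * ?I\<^sup>2"
    by (simp add: ennreal_mult' power2_eq_square mult_ac)
  finally show ?thesis .
qed

section \<open>The exponential integral as an integral over the unit interval\<close>

text \<open>
  The intervals produced by the substitutions differ only at the end points 0 and 1.
\<close>

lemma set_integral_cong_endpoints:
  fixes f :: "real \<Rightarrow> real"
  assumes [measurable]: "A \<in> sets borel" "B \<in> sets borel" "f \<in> borel_measurable borel"
    and AB: "A - {0, 1} = B - {0, 1}"
  shows "set_integrable lborel A f \<longleftrightarrow> set_integrable lborel B f"
    and "(LINT v:A|lborel. f v) = (LINT v:B|lborel. f v)"
proof -
  have ae: "AE v in lborel. indicator A v *\<^sub>R f v = indicator B v *\<^sub>R f v"
    using AE_lborel_singleton[of 0] AE_lborel_singleton[of 1]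
  proof eventually_elim
    case (elim v)
    then have "v \<in> A \<longleftrightarrow> v \<in> B" using AB by blast
    then show ?case by (simp add: indicator_def)
  qed
  show "set_integrable lborel A f \<longleftrightarrow> set_integrable lborel B f"
    unfolding set_integrable_def by (rule integrable_cong_AE[OF _ _ ae]) measurable
  show "(LINT v:A|lborel. f v) = (LINT v:B|lborel. f v)"
    unfolding set_lebesgue_integral_def by (rule integral_cong_AE[OF _ _ ae]) measurable
qed

lemma set_integral_substitution_lborel:
  fixes f g g' :: "real \<Rightarrow> real"
  assumes [measurable]: "S \<in> sets borel" "g ` S \<in> sets borel" "f \<in> borel_measurable borel"
    and der: "\<And>v. v \<in> S \<Longrightarrow> (g has_real_derivative g' v) (at v within S)"
    and inj: "inj_on g S"
    and int: "set_integrable lborel S (\<lambda>v. \<bar>g' v\<bar> * f (g v))"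
  shows "set_integrable lborel (g ` S) f"
    and "(LINT t:g ` S|lborel. f t) = (LINT v:S|lborel. \<bar>g' v\<bar> * f (g v))"
proof -
  have leb: "(\<lambda>v. \<bar>g' v\<bar> * f (g v)) absolutely_integrable_on S"
    using int unfolding set_integrable_def by (subst integrable_completion) (auto dest: borel_measurable_integrable)
  have S: "S \<in> sets lebesgue" by auto
  have *: "f absolutely_integrable_on (g ` S) \<and>
      integral (g ` S) f = integral S (\<lambda>v. \<bar>g' v\<bar> * f (g v))"
    using has_absolute_integral_change_of_variables_1'[OF S der inj, of f] leb by blast
  then show int': "set_integrable lborel (g ` S) f"
    unfolding set_integrable_def by (subst integrable_completion[symmetric]) auto
  show "(LINT t:g ` S|lborel. f t) = (LINT v:S|lborel. \<bar>g' v\<bar> * f (g v))"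
    using * set_borel_integral_eq_integral(2)[OF int] set_borel_integral_eq_integral(2)[OF int'] by simp
qed

text \<open>
  The functions \<open>P\<close> and \<open>Q\<close> arise from the integrand over positive and over negative \<open>t\<close>, respectively.
  For \<open>1 \<le> \<delta> < 2\<close> neither is integrable up to \<open>v = 1\<close>, but their difference is.
\<close>

context
  fixes \<delta> y :: real and P Q :: "real \<Rightarrow> real"
  defines "P \<equiv> \<lambda>v. (1 - v) powr (- \<delta>) * exp (- v * y)"
    and "Q \<equiv> \<lambda>v. (1 - v) powr (- \<delta>) * (v powr (\<delta> - 2) * exp (- y / v))"
  assumes y: "y > 0"
begin

private lemma measurable_PQ [measurable]: "P \<in> borel_measurable borel" "Q \<in> borel_measurable borel"
  unfolding P_def Q_def by measurable

private lemma measurable_integrand [measurable]: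
  "(\<lambda>t. exp t / signed_powr t \<delta>) \<in> borel_measurable borel"
  unfolding signed_powr_def by measurable

private lemma integrand_affine:
  assumes "v \<le> 1"
  shows "y * (exp (y + (- y) * v) / signed_powr (y + (- y) * v) \<delta>) = exp y * y powr (1 - \<delta>) * P v"
proof (cases "v = 1")
  case True
  then show ?thesis by (simp add: signed_powr_def P_def)
next
  case False
  with assms have v: "1 - v > 0" by simp
  have t: "y + (- y) * v = y * (1 - v)" by (simp add: algebra_simps)
  have "signed_powr (y + (- y) * v) \<delta> = y powr \<delta> * (1 - v) powr \<delta>"
    unfolding t using v y by (simp add: signed_powr_def powr_mult)
  moreover have "exp (y + (- y) * v) = exp y * exp (- v * y)"
    by (simp add: exp_add[symmetric] mult.commute)
  moreover have "y powr (1 - \<delta>) = y / y powr \<delta>" using y by (simp add: powr_diff)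
  ultimately show ?thesis by (simp add: P_def powr_minus_divide)
qed

private lemma integral_positive_part:
  assumes "a \<ge> 0" 
  shows "(LINT t:{a..y}|lborel. exp t / signed_powr t \<delta>)
    = exp y * y powr (1 - \<delta>) * (LINT v:{0..1 - a / y}|lborel. P v)"
    and "set_integrable lborel {0..1 - a / y} P \<Longrightarrow>
      set_integrable lborel {a..y} (\<lambda>t. exp t / signed_powr t \<delta>)"
proof -
  let ?F = "\<lambda>t. indicator {a..y} t *\<^sub>R (exp t / signed_powr t \<delta>)"
  have eq: "y * ?F (y + (- y) * v) = (exp y * y powr (1 - \<delta>)) * (indicator {0..1 - a / y} v * P v)" for v
  proof (cases "v \<in> {0..1 - a / y}")
    case True
    then have "y + (- y) * v \<in> {a..y}" "v \<le> 1"
      using y assms by (auto simp: field_simps intro: order_trans[of v "1 - a / y"])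
    then show ?thesis using True integrand_affine[of v] by simp
  next
    case False
    then have "y + (- y) * v \<notin> {a..y}" using y by (auto simp: field_simps zero_le_mult_iff)
    then show ?thesis using False by simp
  qed
  have "(LINT t:{a..y}|lborel. exp t / signed_powr t \<delta>) = (LINT v|lborel. y * ?F (y + (- y) * v))"
    using lborel_integral_real_affine[of "- y" ?F y] y unfolding set_lebesgue_integral_def
    by (simp only: integral_mult_right_zero abs_minus_cancel abs_of_pos real_scaleR_def)
  also have "\<dots> = (LINT v|lborel. (exp y * y powr (1 - \<delta>)) * (indicator {0..1 - a / y} v * P v))"
    unfolding eq ..
  finally show "(LINT t:{a..y}|lborel. exp t / signed_powr t \<delta>)
    = exp y * y powr (1 - \<delta>) * (LINT v:{0..1 - a / y}|lborel. P v)"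
    by (simp add: set_lebesgue_integral_def)
  assume "set_integrable lborel {0..1 - a / y} P"
  then have "integrable lborel (\<lambda>v. (exp y * y powr (1 - \<delta>)) * (indicator {0..1 - a / y} v * P v))"
    by (simp add: set_integrable_def)
  then have "integrable lborel (\<lambda>v. y * ?F (y + (- y) * v))" unfolding eq .
  then have "integrable lborel (\<lambda>v. ?F (y + (- y) * v))"
    using y by (subst (asm) integrable_mult_left_iff) simp
  then show "set_integrable lborel {a..y} (\<lambda>t. exp t / signed_powr t \<delta>)"
    using lborel_integrable_real_affine_iff[of "- y" ?F y] y unfolding set_integrable_def by simp
qed

private lemma integrand_inversion:
  assumes "0 < v" "v < 1"
  shows "\<bar>y / v\<^sup>2\<bar> * (exp (y - y / v) / signed_powr (y - y / v) \<delta>) = - (exp y * y powr (1 - \<delta>)) * Q v"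
proof -
  have t: "y - y / v = - (y * ((1 - v) / v))" using assms by (simp add: field_simps)
  have pos: "y * ((1 - v) / v) > 0" using assms y by simp
  have "signed_powr (y - y / v) \<delta> = - ((y * ((1 - v) / v)) powr \<delta>)"
  proof -
    have "signed_powr (- z) \<delta> = - (z powr \<delta>)" if "z > 0" for z
      using that by (simp add: signed_powr_def)
    then show ?thesis unfolding t using pos by blast
  qed
  also have "(y * ((1 - v) / v)) powr \<delta> = y powr \<delta> * (1 - v) powr \<delta> / v powr \<delta>"
    using assms y by (simp add: powr_mult powr_divide)
  finally have s: "signed_powr (y - y / v) \<delta> = - (y powr \<delta> * (1 - v) powr \<delta> / v powr \<delta>)" .
  have e: "exp (y - y / v) = exp y * exp (- y / v)" by (simp add: exp_add[symmetric])
  have p: "y powr (1 - \<delta>) = y / y powr \<delta>" using y by (simp add: powr_diff)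
  have q: "v powr (\<delta> - 2) = v powr \<delta> / v\<^sup>2" using assms by (simp add: powr_diff powr_numeral)
  have a: "\<bar>y / v\<^sup>2\<bar> = y / v\<^sup>2" using y by simp
  show ?thesis unfolding s e Q_def p q a by (simp add: powr_minus_divide mult_ac)
qed

private lemma integral_negative_part:
  assumes b: "0 < b" "b \<le> 1" and T: "(\<lambda>v. y - y / v) ` ({0<..b} - {1}) = T" and [measurable]: "T \<in> sets borel"
    and int: "set_integrable lborel {0..b} Q"
  shows "(LINT t:T|lborel. exp t / signed_powr t \<delta>)
    = - (exp y * y powr (1 - \<delta>)) * (LINT v:{0..b}|lborel. Q v)"
    and "set_integrable lborel T (\<lambda>t. exp t / signed_powr t \<delta>)"
proof -
  let ?F = "\<lambda>t. exp t / signed_powr t \<delta>"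
  let ?S = "{0<..b} - {1}"
  let ?c = "- (exp y * y powr (1 - \<delta>))"
  have der: "((\<lambda>v. y - y / v) has_real_derivative y / v\<^sup>2) (at v within ?S)" if "v \<in> ?S" for v
    using that by (auto intro!: derivative_eq_intros simp: power2_eq_square)
  have inj: "inj_on (\<lambda>v. y - y / v) ?S"
    using y by (auto simp: inj_on_def)
  have eq: "indicator ?S v *\<^sub>R (\<bar>y / v\<^sup>2\<bar> * ?F (y - y / v)) = ?c * (indicator ?S v *\<^sub>R Q v)" for v
    using integrand_inversion[of v] b by (auto simp: indicator_def)
  have intS: "set_integrable lborel ?S Q"
    using int by (subst set_integral_cong_endpoints(1)[where B = "{0..b}"]) auto
  then have intF: "set_integrable lborel ?S (\<lambda>v. \<bar>y / v\<^sup>2\<bar> * ?F (y - y / v))"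
    unfolding set_integrable_def eq by (rule integrable_mult_right)
  have [measurable]: "(\<lambda>v. y - y / v) ` ?S \<in> sets borel" using T by simp
  note subst = set_integral_substitution_lborel[OF _ _ _ der inj intF]
  show "set_integrable lborel T ?F" using subst(1) T by simp
  have "(LINT t:T|lborel. ?F t) = (LINT v:?S|lborel. \<bar>y / v\<^sup>2\<bar> * ?F (y - y / v))"
    using subst(2) T by simp
  also have "\<dots> = ?c * (LINT v:?S|lborel. Q v)"
    unfolding set_lebesgue_integral_def eq by (rule integral_mult_right_zero)
  also have "(LINT v:?S|lborel. Q v) = (LINT v:{0..b}|lborel. Q v)"
    by (rule set_integral_cong_endpoints(2)) auto
  finally show "(LINT t:T|lborel. ?F t) = ?c * (LINT v:{0..b}|lborel. Q v)" .
qed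

text \<open>
  Deleting the point \<open>v = 1\<close>, the preimage of \<open>t = 0\<close>, makes the case \<open>\<epsilon> = 0\<close> an instance.
\<close>

private lemma inversion_image:
  shows "0 \<le> \<epsilon> \<Longrightarrow> (\<lambda>v. y - y / v) ` ({0<..1 / (1 + \<epsilon> / y)} - {1}) = {..-\<epsilon>} - {0}"
proof -
  assume e: "0 \<le> \<epsilon>"
  have pos: "1 + \<epsilon> / y > 0" using y e by (simp add: add_pos_nonneg)
  have le: "v \<le> 1 / (1 + \<epsilon> / y) \<longleftrightarrow> y - y / v \<le> - \<epsilon>" if "v > 0" for v
    using that y pos by (simp add: field_simps)
  show ?thesis
  proof (intro equalityI subsetI)
    fix t assume "t \<in> (\<lambda>v. y - y / v) ` ({0<..1 / (1 + \<epsilon> / y)} - {1})"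
    then show "t \<in> {..-\<epsilon>} - {0}" using le y by (auto simp: eq_divide_eq)
  next
    fix t assume t: "t \<in> {..-\<epsilon>} - {0}"
    then have "t < 0" using e by auto
    define v where "v = y / (y - t)"
    have "v > 0" "v \<noteq> 1" "y - y / v = t" using y \<open>t < 0\<close> by (auto simp: v_def field_simps)
    then show "t \<in> (\<lambda>v. y - y / v) ` ({0<..1 / (1 + \<epsilon> / y)} - {1})"
      using le[of v] t by (intro image_eqI[of _ _ v]) auto
  qed
qed

private lemma P_le: "v \<ge> 0 \<Longrightarrow> P v \<le> (1 - v) powr (- \<delta>)" "P v \<ge> 0"
  using y by (auto simp: P_def mult_left_le)

text \<open>
  In the principal value, the cut at distance \<open>\<epsilon>\<close> from \<open>t = 0\<close> corresponds to \<open>v \<le> 1 - \<eta>\<close> in \<open>P\<close>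
  and to \<open>v \<le> 1/(1 + \<eta>)\<close> in \<open>Q\<close>, where \<open>\<eta> = \<epsilon>/y\<close>. The mismatch has length of order \<open>\<eta>\<^sup>2\<close> and there \<open>P\<close> is of order
  \<open>\<eta>^(-\<delta>)\<close>, so that it disappears in the limit because of \<open>\<delta> < 2\<close>.
\<close>

lemma Ei_delta_eq:
  assumes \<delta>: "\<delta> < 2" and int: "set_integrable lborel {0<..<1} (\<lambda>v. P v - Q v)"
  shows "Ei_delta \<delta> y = exp y * y powr (1 - \<delta>) * (LINT v:{0<..<1}|lborel. P v - Q v)"
proof -
  let ?F = "\<lambda>t. exp t / signed_powr t \<delta>"
  let ?c = "exp y * y powr (1 - \<delta>)"
  have int': "set_integrable lborel {0..<1} (\<lambda>v. P v - Q v)" "set_integrable lborel {0..1} (\<lambda>v. P v - Q v)"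
    by (subst set_integral_cong_endpoints(1)[where B = "{0<..<1}"], auto intro: int)+
  show ?thesis
  proof (cases "\<delta> < 1")
    case True
    \<comment> \<open>The vacuous power of \<open>v\<close> brings the bound into the form of a Beta integrand; as
      \<open>0 powr 0 = 0\<close>, the end point 0 is left out at first.\<close>
    have "set_integrable lborel {0..1} (\<lambda>v::real. v powr (1 - 1) * (1 - v) powr (1 - \<delta> - 1))"
      using True by (intro integrable_Beta) auto
    then have "set_integrable lborel {0<..1} (\<lambda>v::real. v powr (1 - 1) * (1 - v) powr (1 - \<delta> - 1))"
      by (rule set_integrable_subset) auto
    then have "set_integrable lborel {0<..1} P"
      by (rule set_integrable_bound)
         (use P_le in \<open>auto simp: set_borel_measurable_def intro!: AE_I2\<close>)
    then have P: "set_integrable lborel {0..1} P"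
      by (subst set_integral_cong_endpoints(1)[where B = "{0<..1}"]) auto
    have Q: "set_integrable lborel {0..1} Q"
      using set_integral_diff(1)[OF P int'(2)] by simp
    have img: "(\<lambda>v. y - y / v) ` ({0<..1} - {1}) = {..<0}"
      using inversion_image[of 0] by (auto simp: less_le)
    have "Ei_delta \<delta> y = (LINT t:{..<0} \<union> {0..y}|lborel. ?F t)"
      using True y by (simp add: Ei_delta_def ivl_disj_un_one)
    also have "\<dots> = (LINT t:{..<0}|lborel. ?F t) + (LINT t:{0..y}|lborel. ?F t)"
      using integral_negative_part(2)[OF _ _ img _ Q] integral_positive_part(2)[of 0] P y
      by (intro set_integral_Un) auto
    also have "\<dots> = ?c * ((LINT v:{0..1}|lborel. P v) - (LINT v:{0..1}|lborel. Q v))"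
      using integral_negative_part(1)[OF _ _ img _ Q] integral_positive_part(1)[of 0] y
      by (simp add: algebra_simps)
    also have "(LINT v:{0..1}|lborel. P v) - (LINT v:{0..1}|lborel. Q v) = (LINT v:{0..1}|lborel. P v - Q v)"
      using set_integral_diff(2)[OF P Q] by simp
    also have "\<dots> = (LINT v:{0<..<1}|lborel. P v - Q v)"
      by (rule set_integral_cong_endpoints(2)) auto
    finally show ?thesis .
  next
    case False
    then have d1: "\<delta> \<ge> 1" by simp
    \<comment> \<open>Here \<open>J\<close> collects both parts up to the upper limit of \<open>Q\<close>, and \<open>R\<close> is the surplus of \<open>P\<close>.\<close>
    let ?b = "\<lambda>\<epsilon>. 1 / (1 + \<epsilon> / y)"
    let ?A = "\<lambda>\<epsilon>. (LINT t:{..-\<epsilon>}|lborel. ?F t) + (LINT t:{\<epsilon>..y}|lborel. ?F t)"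
    let ?J = "\<lambda>\<epsilon>. LINT v:{0..?b \<epsilon>}|lborel. P v - Q v"
    let ?R = "\<lambda>\<epsilon>. LINT v:{1 - \<epsilon> / y<..?b \<epsilon>}|lborel. P v"
    have Pbound: "P v \<le> (1 - b) powr (- \<delta>)" if "0 \<le> v" "v \<le> b" "b < 1" for v b
      using that d1 P_le(1)[of v] powr_mono2'[of "- \<delta>" "1 - b" "1 - v"] by auto
    have Pint: "set_integrable lborel {a..b} P" if "0 \<le> a" "b < 1" for a b
      unfolding set_integrable_def
      using that Pbound P_le(2)
      by (intro integrableI_bounded_set_indicator[where B = "(1 - b) powr (- \<delta>)"])
         (auto intro!: AE_I2 simp: emeasure_lborel_Icc_eq)
    have A: "?A \<epsilon> = ?c * (?J \<epsilon> - ?R \<epsilon>)" if e: "0 < \<epsilon>" "\<epsilon> < y" for \<epsilon>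
    proof -
      let ?\<eta> = "\<epsilon> / y"
      have \<eta>: "0 < ?\<eta>" "?\<eta> < 1" using e by auto
      have b: "0 < ?b \<epsilon>" "?b \<epsilon> < 1" "1 - ?\<eta> \<le> ?b \<epsilon>" 
      proof -
        define \<eta> where "\<eta> = \<epsilon> / y"
        have h: "0 < \<eta>" using \<eta> by (simp add: \<eta>_def)
        have "(1 - \<eta>) * (1 + \<eta>) \<le> 1" by (simp add: algebra_simps)
        with h show "0 < ?b \<epsilon>" "?b \<epsilon> < 1" "1 - ?\<eta> \<le> ?b \<epsilon>"
          unfolding \<eta>_def[symmetric] by (simp_all add: le_divide_eq)
      qed
      have P: "set_integrable lborel {0..?b \<epsilon>} P" using b by (intro Pint) auto
      have PQ: "set_integrable lborel {0..?b \<epsilon>} (\<lambda>v. P v - Q v)"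
        using int'(1) by (rule set_integrable_subset) (use b in auto)
      have Q: "set_integrable lborel {0..?b \<epsilon>} Q"
        using set_integral_diff(1)[OF P PQ] by simp
      have img: "(\<lambda>v. y - y / v) ` ({0<..?b \<epsilon>} - {1}) = {..-\<epsilon>}"
        using inversion_image[of \<epsilon>] e by auto
      have "(LINT v:{0..?b \<epsilon>}|lborel. P v) = (LINT v:{0..1 - ?\<eta>} \<union> {1 - ?\<eta><..?b \<epsilon>}|lborel. P v)"
        using b \<eta> by (simp add: ivl_disj_un_two_touch ivl_disj_un_two)
      moreover have "{0..1 - ?\<eta>} \<subseteq> {0..?b \<epsilon>}" "{1 - ?\<eta><..?b \<epsilon>} \<subseteq> {0..?b \<epsilon>}"
        using b \<eta> by auto
      then have "(LINT v:{0..1 - ?\<eta>} \<union> {1 - ?\<eta><..?b \<epsilon>}|lborel. P v)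
          = (LINT v:{0..1 - ?\<eta>}|lborel. P v) + ?R \<epsilon>"
        using set_integrable_subset[OF P] by (intro set_integral_Un) auto
      ultimately have split: "(LINT v:{0..1 - ?\<eta>}|lborel. P v) = (LINT v:{0..?b \<epsilon>}|lborel. P v) - ?R \<epsilon>"
        by simp
      have "?A \<epsilon> = ?c * ((LINT v:{0..1 - ?\<eta>}|lborel. P v) - (LINT v:{0..?b \<epsilon>}|lborel. Q v))"
        using integral_negative_part(1)[OF _ _ img _ Q] integral_positive_part(1)[of \<epsilon>] b e
        by (simp add: algebra_simps)
      also note split
      also have "(LINT v:{0..?b \<epsilon>}|lborel. P v) - ?R \<epsilon> - (LINT v:{0..?b \<epsilon>}|lborel. Q v) = ?J \<epsilon> - ?R \<epsilon>"
        using set_integral_diff(2)[OF P Q] by simp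
      finally show ?thesis .
    qed
    have J: "(?J \<longlongrightarrow> (LINT v:{0..<1}|lborel. P v - Q v)) (at_right 0)"
    proof (rule filterlim_compose[OF tendsto_set_lebesgue_integral_at_left])
      show "filterlim ?b (at_left 1) (at_right 0)"
        unfolding filterlim_at using y
        by (auto intro!: tendsto_eq_intros eventually_at_right_less[THEN eventually_mono] simp: field_simps add_pos_pos)
    qed (use int' in auto)
    have R: "(?R \<longlongrightarrow> 0) (at_right 0)"
    proof (rule Lim_null_comparison)
      have "norm (?R \<epsilon>) \<le> 2 * (\<epsilon> / y) powr (2 - \<delta>)" if e: "0 < \<epsilon>" "\<epsilon> < y" for \<epsilon>
      proof -
        define \<eta> where "\<eta> = \<epsilon> / y"
        define b where "b = ?b \<epsilon>"
        have \<eta>: "0 < \<eta>" "\<eta> < 1" using e by (auto simp: \<eta>_def)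
        have b: "1 - b = \<eta> / (1 + \<eta>)" "b - (1 - \<eta>) = \<eta>\<^sup>2 / (1 + \<eta>)"
          using \<eta> unfolding b_def \<eta>_def[symmetric] by (simp_all add: field_simps power2_eq_square)
        have b01: "b < 1" "1 - \<eta> \<le> b"
        proof -
          have "0 < \<eta> / (1 + \<eta>)" "0 \<le> \<eta>\<^sup>2 / (1 + \<eta>)" using \<eta> by auto
          with b show "b < 1" "1 - \<eta> \<le> b" by linarith+
        qed
        have "set_integrable lborel {1 - \<eta>..b} P" using b01 \<eta> by (intro Pint) auto
        then have Pi: "set_integrable lborel {1 - \<eta><..b} P"
          by (rule set_integrable_subset) auto
        have "?R \<epsilon> \<ge> 0"
          unfolding set_lebesgue_integral_def using P_le(2) \<eta> unfolding \<eta>_def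
          by (intro integral_nonneg_AE AE_I2) (auto simp: indicator_def)
        then have "norm (?R \<epsilon>) = (LINT v:{1 - \<eta><..b}|lborel. P v)" by (simp add: \<eta>_def b_def)
        also have "\<dots> \<le> (LINT v:{1 - \<eta><..b}|lborel. (1 - b) powr (- \<delta>))"
          using Pi Pbound b01 \<eta> by (intro set_integral_mono) (auto simp: set_integrable_def)
        also have "\<dots> = (b - (1 - \<eta>)) * (1 - b) powr (- \<delta>)"
          using b01 by (simp add: set_lebesgue_integral_def)
        also have "\<dots> = \<eta>\<^sup>2 * \<eta> powr (- \<delta>) * ((1 + \<eta>) powr \<delta> / (1 + \<eta>))"
          unfolding b using \<eta> by (simp add: powr_divide powr_minus_divide)
        also have "(1 + \<eta>) powr \<delta> / (1 + \<eta>) = (1 + \<eta>) powr (\<delta> - 1)"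
          using \<eta> by (simp add: powr_diff)
        also have "\<eta>\<^sup>2 * \<eta> powr (- \<delta>) = \<eta> powr (2 - \<delta>)"
          using \<eta> by (simp add: powr_diff powr_minus_divide powr_numeral)
        also have "(1 + \<eta>) powr (\<delta> - 1) \<le> (1 + \<eta>) powr 1"
          using \<eta> \<delta> by (intro powr_mono) auto
        finally have "norm (?R \<epsilon>) \<le> \<eta> powr (2 - \<delta>) * (1 + \<eta>)"
          using \<eta> by (simp add: mult_left_mono)
        also have "\<dots> \<le> \<eta> powr (2 - \<delta>) * 2" using \<eta> by (intro mult_left_mono) auto
        finally show ?thesis by (simp add: \<eta>_def mult.commute)
      qed
      then show "\<forall>\<^sub>F \<epsilon> in at_right 0. norm (?R \<epsilon>) \<le> 2 * (\<epsilon> / y) powr (2 - \<delta>)"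
        unfolding eventually_at_right_field using y by (intro exI[of _ y]) auto
      have "((\<lambda>\<epsilon>. \<epsilon> / y) \<longlongrightarrow> 0) (at_right 0)" using y by (auto intro!: tendsto_eq_intros)
      then have "((\<lambda>\<epsilon>. (\<epsilon> / y) powr (2 - \<delta>)) \<longlongrightarrow> 0) (at_right 0)"
        using \<delta> y by (intro tendsto_zero_powrI[where b = "2 - \<delta>"] tendsto_const)
           (auto simp: eventually_at_right_field intro: exI[of _ 1])
      then show "((\<lambda>\<epsilon>. 2 * (\<epsilon> / y) powr (2 - \<delta>)) \<longlongrightarrow> 0) (at_right 0)"
        by (rule tendsto_mult_right_zero)
    qed
    have "(?A \<longlongrightarrow> ?c * ((LINT v:{0..<1}|lborel. P v - Q v) - 0)) (at_right 0)"
    proof (rule Lim_transform_eventually)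
      show "((\<lambda>\<epsilon>. ?c * (?J \<epsilon> - ?R \<epsilon>)) \<longlongrightarrow> ?c * ((LINT v:{0..<1}|lborel. P v - Q v) - 0)) (at_right 0)"
        by (intro tendsto_intros J R)
      show "\<forall>\<^sub>F \<epsilon> in at_right 0. ?c * (?J \<epsilon> - ?R \<epsilon>) = ?A \<epsilon>"
        unfolding eventually_at_right_field using y A by (intro exI[of _ y]) auto
    qed
    then have "Lim (at_right 0) ?A = ?c * (LINT v:{0..<1}|lborel. P v - Q v)"
      by (intro tendsto_Lim) auto
    also have "(LINT v:{0..<1}|lborel. P v - Q v) = (LINT v:{0<..<1}|lborel. P v - Q v)"
      by (rule set_integral_cong_endpoints(2)) auto
    finally show ?thesis using False by (simp add: Ei_delta_def)
  qed
qed

end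

section \<open>The radial function as a superposition\<close>

text \<open>
  For fixed positive \<open>y\<close> the exponential beats the power as \<open>v\<close> tends to 0; the constant comes from
  \<open>(1 + z/n)^n \<le> exp z\<close> with \<open>z = y/v\<close>.
\<close>

lemma powr_exp_bounded:
  fixes y v :: real
  assumes y: "y > 0" and v: "0 < v" "v < 1" and n: "n > 0"
  shows "v powr (- (real n / 2)) * exp (- y / v) \<le> (real n / y) ^ n"
proof -
  have "v powr (- (real n / 2)) \<le> v powr (- real n)"
    using v by (intro powr_mono') auto
  also have "\<dots> = (1 / v) ^ n" using v by (simp add: powr_minus_divide powr_realpow power_one_over)
  also have "\<dots> = (real n / y) ^ n * (y / v / real n) ^ n"
    using y v n by (simp add: power_mult_distrib[symmetric])
  also have "\<dots> \<le> (real n / y) ^ n * exp (y / v)"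
  proof (intro mult_left_mono)
    have "(y / v / real n) ^ n \<le> (1 + y / v / real n) ^ n"
      using y v by (intro power_mono) auto
    also have "\<dots> \<le> exp (y / v)"
      using y v n by (intro exp_ge_one_plus_x_over_n_power_n) (auto intro: order_trans[of _ 0])
    finally show "(y / v / real n) ^ n \<le> exp (y / v)" .
  qed (use y in auto)
  finally have "v powr (- (real n / 2)) * exp (- y / v) \<le> (real n / y) ^ n * exp (y / v) * exp (- y / v)"
    by (rule mult_right_mono) simp
  also have "\<dots> = (real n / y) ^ n" by (simp add: exp_add[symmetric])
  finally show ?thesis .
qed

text \<open>
  Away from the origin the majorant is bounded in \<open>v\<close>, and the weight \<open>(1 - v)^(D-1)\<close> is integrable. This is the
  absolute convergence that replaces the principal value.
\<close>

lemma integrable_gauss_mix_integrand: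
  fixes x :: "'a::euclidean_space"
  assumes "x \<noteq> 0"
  shows "set_integrable lborel {0<..<1} (\<lambda>v. (1 - v) powr (real DIM('a) / 2 - 2) * gauss_diff v x)"
proof -
  let ?D = "real DIM('a) / 2"
  let ?C = "16 + real DIM('a)"
  define y where "y = (norm x)\<^sup>2 / 2"
  have y: "y > 0" using assms by (simp add: y_def)
  define M where "M = 1 + (real DIM('a) / y) ^ DIM('a)"
  have maj: "gauss_majorant v x \<le> M" if v: "0 < v" "v < 1" for v
    using powr_exp_bounded[OF y v DIM_positive[where 'a='a]] v
    unfolding gauss_majorant_def M_def y_def by (intro add_mono) auto
  have "set_integrable lborel {0..1} (\<lambda>v::real. v powr (1 - 1) * (1 - v) powr (?D - 1))"
    by (intro integrable_Beta) auto
  then have "set_integrable lborel {0<..<1} (\<lambda>v::real. v powr (1 - 1) * (1 - v) powr (?D - 1))"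
    by (rule set_integrable_subset) auto
  then have "set_integrable lborel {0<..<1} (\<lambda>v. (?C * M) * (v powr (1 - 1) * (1 - v) powr (?D - 1)))"
    by (rule set_integrable_mult_right)
  then show ?thesis
  proof (rule set_integrable_bound)
    show "set_borel_measurable lborel {0<..<1} (\<lambda>v. (1 - v) powr (?D - 2) * gauss_diff v x)"
      unfolding set_borel_measurable_def by measurable
    show "AE v in lborel. v \<in> {0<..<1} \<longrightarrow> norm ((1 - v) powr (?D - 2) * gauss_diff v x)
        \<le> norm ((?C * M) * (v powr (1 - 1) * (1 - v) powr (?D - 1)))"
    proof (intro AE_I2 impI)
      fix v :: real assume v: "v \<in> {0<..<1}"
      have "norm ((1 - v) powr (?D - 2) * gauss_diff v x) \<le> ?C * ((1 - v) powr (?D - 1) * gauss_majorant v x)"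
        using weighted_gauss_diff_le[of "{0<..<1}" v x] v by simp
      also have "\<dots> \<le> ?C * ((1 - v) powr (?D - 1) * M)"
        using maj v by (intro mult_left_mono) auto
      also have "\<dots> = (?C * M) * (v powr (1 - 1) * (1 - v) powr (?D - 1))" using v by simp
      finally show "norm ((1 - v) powr (?D - 2) * gauss_diff v x)
        \<le> norm ((?C * M) * (v powr (1 - 1) * (1 - v) powr (?D - 1)))" by (rule order_trans) simp
    qed
  qed
qed

text \<open>
  The powers of the norm cancel: \<open>r^(2-d)\<close> meets \<open>y^(D-1) = r^(d-2) 2^(1-D)\<close> from the exponential integral.
\<close>

lemma phi_eq_gauss_mix:
  fixes x :: "'a::euclidean_space"
  assumes "x \<noteq> 0"
  shows "phi x = 2 powr (1 - real DIM('a) / 2) * gauss_mix {0<..<1} x"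
proof -
  let ?D = "real DIM('a) / 2"
  define r where "r = norm x"
  define y where "y = r\<^sup>2 / 2"
  have r: "r > 0" and y: "y > 0" using assms by (simp_all add: y_def r_def)
  have eq: "(1 - v) powr (- (2 - ?D)) * exp (- v * y)
      - (1 - v) powr (- (2 - ?D)) * (v powr ((2 - ?D) - 2) * exp (- y / v))
    = (1 - v) powr (?D - 2) * gauss_diff v x" for v
    by (simp add: gauss_diff_def y_def r_def right_diff_distrib)
  have "Ei_delta (2 - ?D) y = exp y * y powr (1 - (2 - ?D)) * (LINT v:{0<..<1}|lborel.
      (1 - v) powr (- (2 - ?D)) * exp (- v * y)
      - (1 - v) powr (- (2 - ?D)) * (v powr ((2 - ?D) - 2) * exp (- y / v)))"
    using integrable_gauss_mix_integrand[OF assms] by (intro Ei_delta_eq y) (simp_all only: eq, simp)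
  then have Ei: "Ei_delta (2 - ?D) y = exp y * y powr (?D - 1) * gauss_mix {0<..<1} x"
    unfolding eq gauss_mix_def by simp
  have "r powi (2 - int DIM('a)) * y powr (?D - 1) = 2 powr (1 - ?D)"
  proof -
    have "r powi (2 - int DIM('a)) = r powr (2 - real DIM('a))"
      using r powr_real_of_int'[of r "2 - int DIM('a)"] by simp
    moreover have "y powr (?D - 1) = r powr (2 * (?D - 1)) / 2 powr (?D - 1)"
      using r by (simp add: y_def powr_divide powr_powr flip: powr_numeral)
    moreover have "r powr (2 - real DIM('a)) * r powr (2 * (?D - 1)) = 1"
      using r by (simp add: powr_add[symmetric])
    moreover have "2 powr (1 - ?D) = 1 / 2 powr (?D - 1)"
      using powr_minus_divide[of 2 "?D - 1"] by simp
    ultimately show ?thesis by (simp only: times_divide_eq_right)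
  qed
  moreover have "exp (- y) * exp y = 1" by (simp add: exp_add[symmetric])
  moreover have "r powi (2 - int DIM('a)) * exp (- y) * (exp y * y powr (?D - 1) * gauss_mix {0<..<1} x)
      = (r powi (2 - int DIM('a)) * y powr (?D - 1)) * (exp (- y) * exp y) * gauss_mix {0<..<1} x"
    by (simp only: mult_ac)
  ultimately have "r powi (2 - int DIM('a)) * exp (- y) * (exp y * y powr (?D - 1) * gauss_mix {0<..<1} x)
      = 2 powr (1 - ?D) * gauss_mix {0<..<1} x"
    by (simp only: mult_1_right)
  moreover have "phi x = r powi (2 - int DIM('a)) * exp (- y) * Ei_delta (2 - ?D) y"
    by (simp add: phi_def r_def y_def)
  ultimately show ?thesis by (simp only: Ei)
qed

lemma AE_phi_eq_gauss_mix:
  "AE x in lborel. phi (x :: 'a::euclidean_space) = 2 powr (1 - real DIM('a) / 2) * gauss_mix {0<..<1} x"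
  using AE_lborel_singleton[of 0] by eventually_elim (rule phi_eq_gauss_mix)

text \<open>
  Positivity amounts to \<open>D ln (1/v) < y (1/v - v)\<close> with \<open>y = r\<^sup>2/2\<close>, and
  \<open>ln (1/v) \<le> 1/v - 1 < 1/v - v\<close>.
\<close>

lemma gauss_diff_pos:
  fixes x :: "'a::euclidean_space"
  assumes v: "0 < v" "v < 1" and x: "real DIM('a) < (norm x)\<^sup>2"
  shows "gauss_diff v x > 0"
proof -
  let ?D = "real DIM('a) / 2"
  define y where "y = (norm x)\<^sup>2 / 2"
  have y: "?D < y" using x by (simp add: y_def)
  have "ln (1 / v) \<le> 1 / v - 1" using v by (intro ln_le_minus_one) auto
  also have "\<dots> < 1 / v - v" using v by simp
  finally have "?D * ln (1 / v) < ?D * (1 / v - v)" by (intro mult_strict_left_mono) auto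
  also have "\<dots> < y * (1 / v - v)"
  proof (intro mult_strict_right_mono y)
    have "v < 1" "1 < 1 / v" using v by auto
    then show "0 < 1 / v - v" by linarith
  qed
  finally have "- ?D * ln v - y / v < - v * y" using v by (simp add: ln_div algebra_simps)
  then have "exp (- ?D * ln v) * exp (- y / v) < exp (- v * y)" by (simp add: exp_add[symmetric])
  then show ?thesis using v by (simp add: gauss_diff_def y_def powr_def)
qed

lemma gauss_mix_pos:
  fixes x :: "'a::euclidean_space"
  assumes x: "real DIM('a) < (norm x)\<^sup>2"
  shows "gauss_mix {0<..<1} x > 0"
proof -
  let ?f = "\<lambda>v. indicator {0<..<1} v *\<^sub>R ((1 - v) powr (real DIM('a) / 2 - 2) * gauss_diff v x)"
  have "x \<noteq> 0" using x by auto
  then have int: "integrable lborel ?f"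
    using integrable_gauss_mix_integrand[of x] by (simp add: set_integrable_def)
  have nn: "AE v in lborel. 0 \<le> ?f v"
    using gauss_diff_pos[OF _ _ x] by (intro AE_I2) (auto simp: indicator_def less_imp_le)
  have "\<not> (AE v in lborel. ?f v = 0)"
  proof
    assume "AE v in lborel. ?f v = 0"
    then have "AE v in lborel. v \<notin> {0<..<1::real}"
    proof eventually_elim
      case (elim v)
      then show ?case using gauss_diff_pos[of v x] x by (auto simp: indicator_def)
    qed
    then have "emeasure lborel {0<..<1::real} = 0"
      by (subst (asm) AE_iff_measurable[of "{0<..<1}"]) auto
    then show False by simp
  qed
  then have "integral\<^sup>L lborel ?f \<noteq> 0"
    using integral_nonneg_eq_0_iff_AE[OF int nn] by simp
  moreover have "integral\<^sup>L lborel ?f \<ge> 0" using nn by (rule integral_nonneg_AE)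
  ultimately show ?thesis by (simp add: gauss_mix_def set_lebesgue_integral_def)
qed

lemma phi_not_AE_zero: "\<not> (AE x in lborel. phi (x :: 'a::euclidean_space) = 0)"
proof
  assume "AE x in lborel. phi (x::'a) = 0"
  with AE_phi_eq_gauss_mix have ae: "AE x in lborel. x \<notin> - cball (0::'a) (sqrt (real DIM('a)))"
  proof eventually_elim
    case (elim x)
    then have "gauss_mix {0<..<1} x = 0" by simp
    then have "\<not> real DIM('a) < (norm x)\<^sup>2" using gauss_mix_pos[of x] by auto
    then show ?case by (simp add: real_le_rsqrt)
  qed
  then have "- cball (0::'a) (sqrt (real DIM('a))) \<in> null_sets lborel"
    by (subst (asm) AE_iff_null_sets[symmetric]) auto
  then have "negligible (- cball (0::'a) (sqrt (real DIM('a))))"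
    by (simp add: negligible_iff_null_sets null_sets_completionI)
  moreover have "open (- cball (0::'a) (sqrt (real DIM('a))))" by (simp add: open_Compl)
  moreover have "- cball (0::'a) (sqrt (real DIM('a))) \<noteq> {}"
    using not_bounded_UNIV bounded_cball by (metis Compl_empty_eq double_compl)
  ultimately show False using open_not_negligible by blast
qed

section \<open>Fourier transform of rapidly decreasing functions\<close>

text \<open>
  The weight of \<open>tempered_function\<close>. It also serves as the yardstick of decay for Schwartz
  functions and their transforms, since it is bounded and integrable.
\<close>

definition decay_weight :: "'a::euclidean_space \<Rightarrow> real" where
  "decay_weight x = 1 / (1 + norm x ^ (2 * DIM('a)))"

lemma decay_weight_bounds:
  fixes x :: "'a::euclidean_space"
  shows "0 < decay_weight x" "decay_weight x \<le> 1"
proof -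
  have "0 < 1 + norm x ^ (2 * DIM('a))" by (intro add_pos_nonneg) auto
  then show "0 < decay_weight x" "decay_weight x \<le> 1" by (simp_all add: decay_weight_def divide_le_eq)
qed

lemma measurable_decay_weight [measurable]: "decay_weight \<in> borel_measurable borel"
  unfolding decay_weight_def by measurable

text \<open>
  Comparison with a product of one-dimensional functions gives integrability.
\<close>

lemma decay_weight_le_prod:
  "decay_weight (x::'a::euclidean_space) \<le> 2 ^ DIM('a) * (\<Prod>b\<in>Basis. inverse (1 + (x \<bullet> b)\<^sup>2))"
proof -
  let ?n = "DIM('a)"
  have le: "(x \<bullet> b)\<^sup>2 \<le> (norm x)\<^sup>2" if "b \<in> Basis" for b
    using power_mono[OF Basis_le_norm[OF that, of x], of 2] by simp
  have "(\<Prod>b\<in>(Basis::'a set). 1 + (x \<bullet> b)\<^sup>2) \<le> (\<Prod>b\<in>(Basis::'a set). 1 + (norm x)\<^sup>2)"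
    using le by (intro prod_mono) auto
  also have "\<dots> = (1 + (norm x)\<^sup>2) ^ ?n" by simp
  also have "\<dots> \<le> 2 ^ ?n * (1 + norm x ^ (2 * ?n))"
  proof (cases "norm x \<le> 1")
    case True
    then have "(1 + (norm x)\<^sup>2) ^ ?n \<le> 2 ^ ?n" by (intro power_mono) (auto simp: power_le_one)
    also have "\<dots> \<le> 2 ^ ?n * (1 + norm x ^ (2 * ?n))" by simp
    finally show ?thesis .
  next
    case False
    then have "1 \<le> (norm x)\<^sup>2" by simp
    then have "(1 + (norm x)\<^sup>2) ^ ?n \<le> (2 * (norm x)\<^sup>2) ^ ?n" by (intro power_mono) auto
    also have "\<dots> \<le> 2 ^ ?n * (1 + norm x ^ (2 * ?n))" by (simp add: power_mult_distrib power_mult)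
    finally show ?thesis .
  qed
  finally have *: "(\<Prod>b\<in>(Basis::'a set). 1 + (x \<bullet> b)\<^sup>2) \<le> 2 ^ ?n * (1 + norm x ^ (2 * ?n))" .
  have pos: "(\<Prod>b\<in>(Basis::'a set). 1 + (x \<bullet> b)\<^sup>2) > 0" by (intro prod_pos) (auto intro: add_pos_nonneg)
  have "0 < 1 + norm x ^ (2 * ?n)" by (intro add_pos_nonneg) auto
  then have "1 / (1 + norm x ^ (2 * ?n)) \<le> 2 ^ ?n / (\<Prod>b\<in>(Basis::'a set). 1 + (x \<bullet> b)\<^sup>2)"
    using * pos by (simp add: divide_simps mult.commute)
  then show ?thesis
    by (simp add: decay_weight_def prod_inversef[symmetric] divide_inverse o_def)
qed

lemma integrable_decay_weight: "integrable lborel (decay_weight :: 'a::euclidean_space \<Rightarrow> real)"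
proof (rule integrableI_nonneg)
  have "integrable lborel (\<lambda>s::real. inverse (1 + s\<^sup>2))"
    using integrable_inverse_1_plus_square by (simp add: set_integrable_def)
  then have fin: "(\<integral>\<^sup>+ s. ennreal (inverse (1 + s\<^sup>2)) \<partial>lborel) < \<infinity>"
    by (subst nn_integral_eq_integral) auto
  have "(\<integral>\<^sup>+ x. ennreal (decay_weight x) \<partial>(lborel :: 'a measure))
     \<le> (\<integral>\<^sup>+ x. ennreal (2 ^ DIM('a)) * (\<Prod>b\<in>Basis. ennreal (inverse (1 + (x \<bullet> b)\<^sup>2))) \<partial>(lborel :: 'a measure))"
    using decay_weight_le_prod by (intro nn_integral_mono) (simp add: prod_ennreal ennreal_mult'[symmetric] prod_nonneg ennreal_leI del: prod_inversef)
  also have "\<dots> = ennreal (2 ^ DIM('a)) * (\<Prod>b\<in>(Basis :: 'a set). \<integral>\<^sup>+ s. ennreal (inverse (1 + s\<^sup>2)) \<partial>lborel)"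
    by (subst nn_integral_cmult, measurable) (subst nn_integral_lborel_prod, auto)
  also have "\<dots> < \<infinity>" using fin by (simp add: ennreal_mult_less_top power_less_top_ennreal)
  finally show "(\<integral>\<^sup>+ x. ennreal (decay_weight x) \<partial>(lborel :: 'a measure)) < \<infinity>" .
qed (auto simp: less_imp_le decay_weight_bounds)

lemma integrable_le_decay_weight:
  fixes F :: "'a::euclidean_space \<Rightarrow> complex"
  assumes "F \<in> borel_measurable borel" "\<And>x. cmod (F x) \<le> C * decay_weight x"
  shows "integrable lborel F"
  by (rule Bochner_Integration.integrable_bound[OF integrable_mult_right[OF integrable_decay_weight, of C]])
     (use assms in \<open>auto intro!: AE_I2 order_trans[OF assms(2)]\<close>)

text \<open>
  Stability under bounded shifts turns a bound for a derivative into one for difference quotients.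
\<close>

lemma decay_weight_shift:
  fixes x b :: "'a::euclidean_space"
  assumes "norm b \<le> 1"
  shows "decay_weight (x + b) \<le> (1 + 2 ^ (2 * DIM('a))) * decay_weight x"
proof -
  let ?N = "2 * DIM('a)"
  define a where "a = norm (x + b)"
  have a: "a \<ge> 0" by (simp add: a_def)
  have "norm x \<le> a + norm b" using norm_triangle_ineq4[of "x + b" b] by (simp add: a_def)
  then have "norm x ^ ?N \<le> (a + 1) ^ ?N" using assms by (intro power_mono) auto
  also have "\<dots> \<le> 2 ^ ?N * (1 + a ^ ?N)"
  proof (cases "a \<le> 1")
    case True
    then have "(a + 1) ^ ?N \<le> 2 ^ ?N" using a by (intro power_mono) auto
    also have "\<dots> \<le> 2 ^ ?N * (1 + a ^ ?N)" using a by simp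
    finally show ?thesis .
  next
    case False
    then have "(a + 1) ^ ?N \<le> (2 * a) ^ ?N" using a by (intro power_mono) auto
    also have "\<dots> \<le> 2 ^ ?N * (1 + a ^ ?N)" by (simp add: power_mult_distrib)
    finally show ?thesis .
  qed
  finally have "1 + norm x ^ ?N \<le> (1 + a ^ ?N) + 2 ^ ?N * (1 + a ^ ?N)"
    using zero_le_power[OF a, of ?N] by linarith
  then have "1 + norm x ^ ?N \<le> (1 + 2 ^ ?N) * (1 + a ^ ?N)" by (simp add: algebra_simps)
  moreover have "0 < 1 + norm x ^ ?N" "0 < 1 + a ^ ?N" using a by (auto intro: add_pos_nonneg)
  ultimately show ?thesis unfolding decay_weight_def a_def[symmetric] by (simp add: divide_simps mult.commute)
qed

lemma integral_lborel_translate: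
  fixes f :: "'a::euclidean_space \<Rightarrow> complex"
  assumes [measurable]: "f \<in> borel_measurable borel"
  shows "(LINT x|lborel. f (x + c)) = (LINT x|lborel. f x)"
    and "integrable lborel f \<Longrightarrow> integrable lborel (\<lambda>x. f (x + c))"
proof -
  have "(LINT x|distr lborel borel ((+) c). f x) = (LINT x|lborel. f (c + x))"
    by (rule integral_distr) auto
  then show "(LINT x|lborel. f (x + c)) = (LINT x|lborel. f x)"
    by (simp add: lborel_distr_plus add.commute)
  assume "integrable lborel f"
  then have "integrable (distr lborel borel ((+) c)) f" by (simp add: lborel_distr_plus)
  then show "integrable lborel (\<lambda>x. f (x + c))"
    by (subst (asm) integrable_distr_eq) (auto simp: add.commute)
qed

text \<open>
  Translation of the integral evaluates the transform of a difference quotient of \<open>F\<close> exactly, as a difference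
  quotient of a character times the transform of \<open>F\<close>. By the mean value inequality the difference quotients of \<open>F\<close> are
  dominated by a multiple of the weight, and dominated convergence gives the claim without integration by parts.
\<close>

lemma fourier_directional_derivative:
  fixes F :: "'a::euclidean_space \<Rightarrow> complex"
  assumes diff: "\<And>x. F differentiable (at x)" and b: "norm b \<le> 1"
    and F: "\<And>x. cmod (F x) \<le> C * decay_weight x"
    and G: "\<And>x. cmod (frechet_derivative F (at x) b) \<le> C' * decay_weight x"
    and G_meas [measurable]: "(\<lambda>x. frechet_derivative F (at x) b) \<in> borel_measurable borel"
  shows "fourier (\<lambda>x. frechet_derivative F (at x) b) t = \<i> * complex_of_real (t \<bullet> b) * fourier F t"
proof -
  let ?G = "\<lambda>x. frechet_derivative F (at x) b"
  let ?e = "\<lambda>x. exp (- \<i> * complex_of_real (t \<bullet> x))"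
  define h :: "nat \<Rightarrow> real" where "h n = 1 / real (Suc n)" for n
  have h: "0 < h n" "h n \<le> 1" for n by (auto simp: h_def)
  have h0: "h \<longlonglongrightarrow> 0" unfolding h_def using LIMSEQ_inverse_real_of_nat by (simp add: inverse_eq_divide)
  have [measurable]: "F \<in> borel_measurable borel"
    using diff by (intro borel_measurable_continuous_onI differentiable_imp_continuous_on)
       (auto simp: differentiable_on_def intro: differentiable_at_withinI)
  have line: "((\<lambda>s. F (x + s *\<^sub>R b)) has_derivative (\<lambda>s. s *\<^sub>R ?G (x + s0 *\<^sub>R b))) (at s0)" for x s0
  proof -
    have "(F has_derivative frechet_derivative F (at (x + s0 *\<^sub>R b))) (at (x + s0 *\<^sub>R b))"
      using diff frechet_derivative_works by blast
    then have "((\<lambda>s. F (x + s *\<^sub>R b)) has_derivative (\<lambda>s. frechet_derivative F (at (x + s0 *\<^sub>R b)) (s *\<^sub>R b))) (at s0)"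
      by (rule has_derivative_compose[rotated, where g = F]) (auto intro!: derivative_eq_intros)
    then show ?thesis
      using linear_frechet_derivative[OF diff] by (simp add: linear_cmul)
  qed
  define q where "q n x = (F (x + h n *\<^sub>R b) - F x) / complex_of_real (h n)" for n x
  have [measurable]: "q n \<in> borel_measurable borel" for n unfolding q_def by measurable
  have C': "C' \<ge> 0" using G[of 0] decay_weight_bounds[of "0::'a"] norm_ge_zero[of "?G 0"]
    by (metis zero_le_mult_iff linorder_not_le order.trans)
  let ?K = "1 + 2 ^ (2 * DIM('a)) :: real"
  have q_bound: "cmod (q n x) \<le> C' * ?K * decay_weight x" for n x
  proof -
    have "continuous_on {0..h n} (\<lambda>s. F (x + s *\<^sub>R b))"
      using line by (meson has_derivative_continuous continuous_at_imp_continuous_on)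
    then obtain s where s: "s \<in> {0<..<h n}"
      and "norm (F (x + h n *\<^sub>R b) - F (x + 0 *\<^sub>R b)) \<le> norm ((h n - 0) *\<^sub>R ?G (x + s *\<^sub>R b))"
      using mvt_general[of 0 "h n" "\<lambda>s. F (x + s *\<^sub>R b)" "\<lambda>s0 s. s *\<^sub>R ?G (x + s0 *\<^sub>R b)"] h[of n] line
      by blast
    then have "cmod (F (x + h n *\<^sub>R b) - F x) \<le> h n * cmod (?G (x + s *\<^sub>R b))"
      using h[of n] by simp
    also have "\<dots> \<le> h n * (C' * (?K * decay_weight x))"
    proof (intro mult_left_mono)
      have "norm (s *\<^sub>R b) \<le> 1" using s h[of n] b mult_mono[of "\<bar>s\<bar>" 1 "norm b" 1] by auto
      then have "C' * decay_weight (x + s *\<^sub>R b) \<le> C' * (?K * decay_weight x)"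
        using C' by (intro mult_left_mono decay_weight_shift)
      then show "cmod (?G (x + s *\<^sub>R b)) \<le> C' * (?K * decay_weight x)"
        using G[of "x + s *\<^sub>R b"] by linarith
    qed (use h[of n] in auto)
    finally show ?thesis using h[of n] by (simp add: q_def norm_divide divide_le_eq mult_ac)
  qed
  have q_lim: "(\<lambda>n. q n x) \<longlonglongrightarrow> ?G x" for x
  proof -
    have "((\<lambda>s. norm (F (x + s *\<^sub>R b) - F x - s *\<^sub>R ?G x) / norm s) \<longlongrightarrow> 0) (at 0)"
      using line[of x 0] by (simp add: has_derivative_at)
    moreover have "h n \<in> UNIV - {0}" for n using h(1)[of n] by simp
    ultimately have "(\<lambda>n. norm (F (x + h n *\<^sub>R b) - F x - h n *\<^sub>R ?G x) / norm (h n)) \<longlonglongrightarrow> 0"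
      using h0 unfolding tendsto_at_iff_sequentially by (auto simp: o_def)
    moreover have "norm (F (x + h n *\<^sub>R b) - F x - h n *\<^sub>R ?G x) / norm (h n) = norm (q n x - ?G x)" for n
    proof -
      have "q n x - ?G x = (F (x + h n *\<^sub>R b) - F x - h n *\<^sub>R ?G x) / complex_of_real (h n)"
        using h(1)[of n] by (simp add: q_def diff_divide_distrib scaleR_conv_of_real)
      then show ?thesis by (simp add: norm_divide)
    qed
    ultimately show ?thesis by (simp add: tendsto_norm_zero_iff LIM_zero_iff)
  qed
  have lim1: "(\<lambda>n. LINT x|lborel. ?e x * q n x) \<longlonglongrightarrow> (LINT x|lborel. ?e x * ?G x)"
  proof (rule integral_dominated_convergence[where w = "\<lambda>x. C' * ?K * decay_weight x"])
    show "integrable lborel (\<lambda>x::'a. C' * ?K * decay_weight x)"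
      by (intro integrable_mult_right integrable_decay_weight)
    show "AE x in lborel. (\<lambda>n. ?e x * q n x) \<longlonglongrightarrow> ?e x * ?G x"
      by (intro AE_I2 tendsto_mult_left q_lim)
    show "AE x in lborel. norm (?e x * q n x) \<le> C' * ?K * decay_weight x" for n
      using q_bound by (intro AE_I2) (simp add: norm_mult)
  qed measurable
  have intF: "integrable lborel F" by (rule integrable_le_decay_weight[OF _ F]) measurable
  have q_int: "(LINT x|lborel. ?e x * q n x)
      = (exp (complex_of_real (h n) * (\<i> * complex_of_real (t \<bullet> b))) - 1) / complex_of_real (h n) * fourier F t" for n
  proof -
    let ?c = "exp (complex_of_real (h n) * (\<i> * complex_of_real (t \<bullet> b)))"
    have inteF: "integrable lborel (\<lambda>x. ?e x * F x)"
      using intF by (rule Bochner_Integration.integrable_bound) (auto simp: norm_mult)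
    have e: "?e x = ?c * ?e (x + h n *\<^sub>R b)" for x
      by (simp add: exp_add[symmetric] inner_add_right algebra_simps)
    have i1: "integrable lborel (\<lambda>x. ?e (x + h n *\<^sub>R b) * F (x + h n *\<^sub>R b))"
      using integral_lborel_translate(2)[OF _ inteF] by simp
    have "?e x * q n x = (?c * (?e (x + h n *\<^sub>R b) * F (x + h n *\<^sub>R b)) - ?e x * F x) / complex_of_real (h n)" for x
    proof -
      have "?e x * F (x + h n *\<^sub>R b) = ?c * (?e (x + h n *\<^sub>R b) * F (x + h n *\<^sub>R b))"
        by (subst e) (simp only: mult.assoc)
      then show ?thesis unfolding q_def by (simp only: times_divide_eq_right right_diff_distrib)
    qed
    then have "(LINT x|lborel. ?e x * q n x) =
       ((LINT x|lborel. ?c * (?e (x + h n *\<^sub>R b) * F (x + h n *\<^sub>R b))) - (LINT x|lborel. ?e x * F x)) / complex_of_real (h n)"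
      using i1 inteF by (simp only: integral_divide_zero Bochner_Integration.integral_diff integrable_mult_right)
    also have "(LINT x|lborel. ?c * (?e (x + h n *\<^sub>R b) * F (x + h n *\<^sub>R b))) = ?c * fourier F t"
      using integral_lborel_translate(1)[of "\<lambda>x. ?e x * F x" "h n *\<^sub>R b"]
      by (simp only: integral_mult_right_zero fourier_def) measurable
    finally show ?thesis by (simp add: fourier_def algebra_simps diff_divide_distrib)
  qed
  have "(\<lambda>n. (exp (complex_of_real (h n) * (\<i> * complex_of_real (t \<bullet> b))) - 1) / complex_of_real (h n))
     \<longlonglongrightarrow> \<i> * complex_of_real (t \<bullet> b)"
  proof -
    let ?z = "\<i> * complex_of_real (t \<bullet> b)"
    have "((\<lambda>w. exp (w * ?z)) has_field_derivative ?z) (at 0)"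
      by (auto intro!: derivative_eq_intros)
    then have "((\<lambda>w. (exp (w * ?z) - 1) / w) \<longlongrightarrow> ?z) (at 0)"
      by (simp add: has_field_derivative_iff)
    moreover have "(\<lambda>n. complex_of_real (h n)) \<longlonglongrightarrow> 0" using tendsto_of_real[OF h0, where 'a=complex] by simp
    moreover have "complex_of_real (h n) \<noteq> 0" for n using h(1)[of n] by simp
    ultimately show ?thesis 
      unfolding tendsto_at_iff_sequentially by (auto simp: o_def)
  qed
  then have "(\<lambda>n. LINT x|lborel. ?e x * q n x) \<longlonglongrightarrow> \<i> * complex_of_real (t \<bullet> b) * fourier F t"
    unfolding q_int by (rule tendsto_mult_right)
  with lim1 show ?thesis unfolding fourier_def by (rule LIMSEQ_unique)
qed

lemma schwartz_decay:
  fixes \<psi> :: "'a::euclidean_space \<Rightarrow> complex"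
  assumes "\<psi> \<in> schwartz" "bs \<in> lists Basis"
  obtains C where "\<And>x. cmod (iter_partial bs \<psi> x) \<le> C * decay_weight x"
proof -
  let ?F = "iter_partial bs \<psi>"
  have ex: "\<exists>C. \<forall>x. norm x ^ k * cmod (?F x) \<le> C" for k
    using assms by (auto simp: schwartz_def)
  obtain C0 where C0: "\<And>x. norm x ^ 0 * cmod (?F x) \<le> C0" using ex by blast
  obtain C1 where C1: "\<And>x. norm x ^ (2 * DIM('a)) * cmod (?F x) \<le> C1" using ex by blast
  show ?thesis
  proof (rule that)
    fix x :: 'a
    have pos: "0 < 1 + norm x ^ (2 * DIM('a))" by (intro add_pos_nonneg) auto
    have "(1 + norm x ^ (2 * DIM('a))) * cmod (?F x) \<le> C0 + C1"
      using C0[of x] C1[of x] by (simp add: algebra_simps)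
    then show "cmod (?F x) \<le> (C0 + C1) * decay_weight x"
      using pos by (simp add: decay_weight_def pos_le_divide_eq mult.commute)
  qed
qed

lemma schwartz_measurable:
  assumes "\<psi> \<in> schwartz" "bs \<in> lists Basis"
  shows "iter_partial bs \<psi> \<in> borel_measurable borel"
  using assms by (intro borel_measurable_continuous_onI differentiable_imp_continuous_on)
     (auto simp: differentiable_on_def schwartz_def intro: differentiable_at_withinI)

lemma schwartz_integrable:
  assumes "\<psi> \<in> schwartz" "bs \<in> lists Basis"
  shows "integrable lborel (iter_partial bs \<psi>)"
  using schwartz_decay[OF assms] schwartz_measurable[OF assms] integrable_le_decay_weight by metis

lemma fourier_iter_partial:
  fixes \<psi> :: "'a::euclidean_space \<Rightarrow> complex"
  assumes \<psi>: "\<psi> \<in> schwartz" and b: "b \<in> Basis"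
  shows "fourier (iter_partial (replicate k b) \<psi>) t = (\<i> * complex_of_real (t \<bullet> b)) ^ k * fourier \<psi> t"
proof (induction k)
  case (Suc k)
  let ?bs = "replicate k b"
  have bs: "?bs \<in> lists Basis" "replicate (Suc k) b \<in> lists Basis" using b by auto
  obtain C where C: "\<And>x. cmod (iter_partial ?bs \<psi> x) \<le> C * decay_weight x"
    using schwartz_decay[OF \<psi> bs(1)] by blast
  obtain C' where C': "\<And>x. cmod (iter_partial (replicate (Suc k) b) \<psi> x) \<le> C' * decay_weight x"
    using schwartz_decay[OF \<psi> bs(2)] by blast
  have "fourier (\<lambda>x. frechet_derivative (iter_partial ?bs \<psi>) (at x) b) t
     = \<i> * complex_of_real (t \<bullet> b) * fourier (iter_partial ?bs \<psi>) t"
  proof (rule fourier_directional_derivative)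
    show "iter_partial ?bs \<psi> differentiable at x" for x using \<psi> bs(1) by (auto simp: schwartz_def)
    show "norm b \<le> 1" using b by simp
  qed (use C C' schwartz_measurable[OF \<psi> bs(2)] in auto)
  then show ?case using Suc.IH by simp
qed simp

text \<open>
  Powers of a coordinate of \<open>t\<close> are controlled by derivatives of \<open>\<psi>\<close> in that direction. For given
  \<open>t\<close> the coordinate of largest absolute value is chosen, which is comparable to the norm.
\<close>

lemma fourier_schwartz_decay:
  fixes \<psi> :: "'a::euclidean_space \<Rightarrow> complex"
  assumes \<psi>: "\<psi> \<in> schwartz"
  obtains C where "\<And>t. cmod (fourier \<psi> t) \<le> C * decay_weight t"
proof -
  let ?N = "2 * DIM('a)"
  define A where "A k b = (LINT x|lborel. cmod (iter_partial (replicate k b) \<psi> x))" for k b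
  have A0: "A k b \<ge> 0" for k b unfolding A_def by (intro integral_nonneg_AE) auto
  have A: "\<bar>t \<bullet> b\<bar> ^ k * cmod (fourier \<psi> t) \<le> A k b" if b: "b \<in> Basis" for k b t
  proof -
    have bs: "replicate k b \<in> lists Basis" using b by auto
    have "\<bar>t \<bullet> b\<bar> ^ k * cmod (fourier \<psi> t) = cmod (fourier (iter_partial (replicate k b) \<psi>) t)"
      by (simp add: fourier_iter_partial[OF \<psi> b] norm_mult norm_power)
    also have "\<dots> \<le> (LINT x|lborel. cmod (exp (- \<i> * complex_of_real (t \<bullet> x)) * iter_partial (replicate k b) \<psi> x))"
      unfolding fourier_def by (rule integral_norm_bound)
    also have "\<dots> = A k b" by (simp add: A_def norm_mult)
    finally show ?thesis .
  qed
  \<comment> \<open>\<open>A 0\<close> involves no derivative, so that its second argument is immaterial.\<close>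
  define C where "C = A 0 undefined + real DIM('a) ^ ?N * (\<Sum>b\<in>Basis. A ?N b)"
  show ?thesis
  proof (rule that)
    fix t :: 'a
    have "Max ((\<lambda>b. \<bar>t \<bullet> b\<bar>) ` Basis) \<in> (\<lambda>b. \<bar>t \<bullet> b\<bar>) ` Basis" by (intro Max_in) auto
    then obtain b where b0: "b \<in> Basis" "Max ((\<lambda>b. \<bar>t \<bullet> b\<bar>) ` Basis) = \<bar>t \<bullet> b\<bar>" by blast
    have b: "b \<in> Basis" "\<And>b'. b' \<in> Basis \<Longrightarrow> \<bar>t \<bullet> b'\<bar> \<le> \<bar>t \<bullet> b\<bar>"
      using b0(1) by (auto simp flip: b0(2))
    have "norm t \<le> (\<Sum>b'\<in>Basis. \<bar>t \<bullet> b'\<bar>)" by (rule norm_le_l1)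
    also have "\<dots> \<le> (\<Sum>b'\<in>(Basis::'a set). \<bar>t \<bullet> b\<bar>)" by (intro sum_mono b)
    finally have "norm t ^ ?N \<le> (real DIM('a) * \<bar>t \<bullet> b\<bar>) ^ ?N" by (intro power_mono) auto
    then have "norm t ^ ?N * cmod (fourier \<psi> t) \<le> (real DIM('a) * \<bar>t \<bullet> b\<bar>) ^ ?N * cmod (fourier \<psi> t)"
      by (rule mult_right_mono) simp
    also have "\<dots> = real DIM('a) ^ ?N * (\<bar>t \<bullet> b\<bar> ^ ?N * cmod (fourier \<psi> t))"
      by (simp add: power_mult_distrib)
    also have "\<dots> \<le> real DIM('a) ^ ?N * A ?N b" using A[OF b(1)] by (intro mult_left_mono) auto
    also have "\<dots> \<le> real DIM('a) ^ ?N * (\<Sum>b\<in>Basis. A ?N b)"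
      using b(1) A0 by (intro mult_left_mono member_le_sum) auto
    finally have 1: "norm t ^ ?N * cmod (fourier \<psi> t) \<le> real DIM('a) ^ ?N * (\<Sum>b\<in>Basis. A ?N b)" .
    have "cmod (fourier \<psi> t) \<le> A 0 undefined" using A[OF b(1), of t 0] by (simp add: A_def)
    with 1 have "(1 + norm t ^ ?N) * cmod (fourier \<psi> t) \<le> C" by (simp add: C_def algebra_simps)
    moreover have "0 < 1 + norm t ^ ?N" by (intro add_pos_nonneg) auto
    ultimately show "cmod (fourier \<psi> t) \<le> C * decay_weight t"
      by (simp add: decay_weight_def pos_le_divide_eq mult.commute)
  qed
qed

lemma measurable_fourier:
  fixes f :: "'a::euclidean_space \<Rightarrow> complex"
  assumes [measurable]: "f \<in> borel_measurable borel"
  shows "fourier f \<in> borel_measurable borel"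
  unfolding fourier_def by measurable

lemma fourier_multiplication_formula:
  fixes f g :: "'a::euclidean_space \<Rightarrow> complex"
  assumes f: "integrable lborel f" and g: "integrable lborel g"
  shows "(LINT x|lborel. f x * fourier g x) = (LINT t|lborel. fourier f t * g t)"
proof -
  have [measurable]: "f \<in> borel_measurable borel" "g \<in> borel_measurable borel"
    using f g by (simp_all add: borel_measurable_integrable)
  let ?H = "\<lambda>x t. f x * (exp (- \<i> * complex_of_real (x \<bullet> t)) * g t)"
  have "integrable (lborel \<Otimes>\<^sub>M lborel) (case_prod ?H)"
  proof (rule integrableI_bounded)
    have "(\<integral>\<^sup>+ p. ennreal (norm (case_prod ?H p)) \<partial>(lborel \<Otimes>\<^sub>M lborel))
       = (\<integral>\<^sup>+ x. \<integral>\<^sup>+ t. ennreal (norm (?H x t)) \<partial>lborel \<partial>lborel)"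
      by (subst lborel.nn_integral_fst[symmetric]) auto
    also have "\<dots> = (\<integral>\<^sup>+ x. ennreal (norm (f x)) * (\<integral>\<^sup>+ t. ennreal (norm (g t)) \<partial>lborel) \<partial>lborel)"
      by (simp add: norm_mult ennreal_mult' nn_integral_cmult)
    also have "\<dots> = (\<integral>\<^sup>+ x. ennreal (norm (f x)) \<partial>lborel) * (\<integral>\<^sup>+ t. ennreal (norm (g t)) \<partial>lborel)"
      by (rule nn_integral_multc) auto
    also have "\<dots> < \<infinity>" using f g by (simp add: integrable_iff_bounded ennreal_mult_less_top)
    finally show "(\<integral>\<^sup>+ p. ennreal (norm (case_prod ?H p)) \<partial>(lborel \<Otimes>\<^sub>M lborel)) < \<infinity>" .
  qed measurable
  from lborel_pair.Fubini_integral[OF this]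
  have "(LINT t|lborel. LINT x|lborel. ?H x t) = (LINT x|lborel. LINT t|lborel. ?H x t)" .
  moreover have "(LINT t|lborel. ?H x t) = f x * fourier g x" for x
    unfolding fourier_def by (rule integral_mult_right_zero)
  moreover have "(LINT x|lborel. ?H x t) = fourier f t * g t" for t
  proof -
    have "(LINT x|lborel. ?H x t) = (LINT x|lborel. (exp (- \<i> * complex_of_real (t \<bullet> x)) * f x) * g t)"
      by (simp only: inner_commute[of t] mult_ac)
    also have "\<dots> = fourier f t * g t" unfolding fourier_def by (rule integral_mult_left_zero)
    finally show ?thesis .
  qed
  ultimately show ?thesis by (simp only:)
qed

section \<open>The eigenvalue equation in the three senses\<close>

lemma measurable_phi [measurable]: "phi \<in> borel_measurable (borel :: 'a::euclidean_space measure)"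
proof -
  have "phi = (\<lambda>x::'a. if x = 0 then phi (0::'a) else 2 powr (1 - real DIM('a) / 2) * gauss_mix {0<..<1} x)"
    using phi_eq_gauss_mix by (auto simp: fun_eq_iff)
  moreover have "(\<lambda>x::'a. if x = 0 then phi (0::'a) else 2 powr (1 - real DIM('a) / 2) * gauss_mix {0<..<1} x)
      \<in> borel_measurable borel"
    by measurable
  ultimately show ?thesis by metis
qed

lemma fourier_cong_AE:
  assumes "f \<in> borel_measurable borel" "g \<in> borel_measurable borel" "AE x in lborel. f x = g x"
  shows "fourier f t = fourier g t"
  unfolding fourier_def
proof (rule integral_cong_AE)
  show "AE x in lborel. exp (- \<i> * complex_of_real (t \<bullet> x)) * f x = exp (- \<i> * complex_of_real (t \<bullet> x)) * g x"
    using assms(3) by eventually_elim simp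
qed (use assms(1,2) in measurable)

lemma fourier_cmult: "fourier (\<lambda>x. c * f x) t = c * fourier f t"
  unfolding fourier_def by (simp add: mult.left_commute)

lemma fourier_L1_phi:
  assumes d: "DIM('a::euclidean_space) = 1"
  shows "fourier_L1 (\<lambda>x::'a. complex_of_real (phi x))
    (\<lambda>x. complex_of_real (- ((2 * pi) powr (real DIM('a) / 2)) * phi x))"
proof -
  let ?D = "real DIM('a) / 2"
  let ?c = "complex_of_real (2 powr (1 - ?D))"
  let ?m = "\<lambda>x::'a. complex_of_real (gauss_mix {0<..<1} x)"
  have fin: "(\<integral>\<^sup>+ v. indicator {0<..<1} v * ennreal ((1 - v) powr (?D - 1) * v powr (- ?D)) \<partial>lborel) < \<infinity>"
    using nn_integral_Beta_finite[of "1 / 2" "1 / 2" "{0<..<1}"] d by auto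
  note mix = fourier_gauss_mix[OF _ _ fin, simplified]
  have ae: "AE x in lborel. complex_of_real (phi (x::'a)) = ?c * ?m x"
    using AE_phi_eq_gauss_mix by eventually_elim simp
  have "integrable lborel (\<lambda>x. ?c * ?m x)" using mix(1) by simp
  then have "integrable lborel (\<lambda>x::'a. complex_of_real (phi x))"
    by (subst integrable_cong_AE[OF _ _ ae]) auto
  moreover have "AE t in lborel. fourier (\<lambda>x::'a. complex_of_real (phi x)) t
      = complex_of_real (- ((2 * pi) powr ?D) * phi t)"
    using ae
  proof eventually_elim
    case (elim t)
    have "fourier (\<lambda>x::'a. complex_of_real (phi x)) t = fourier (\<lambda>x. ?c * ?m x) t"
      by (rule fourier_cong_AE[OF _ _ ae]) auto
    also have "\<dots> = - complex_of_real ((2 * pi) powr ?D) * (?c * ?m t)"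
      unfolding fourier_cmult using mix(2)[of t] by simp
    finally show ?case unfolding elim[symmetric] by simp
  qed
  ultimately show ?thesis unfolding fourier_L1_def by simp
qed

lemma gauss_mix_Un:
  fixes x :: "'a::euclidean_space"
  assumes "x \<noteq> 0" "A \<in> sets borel" "B \<in> sets borel" "A \<inter> B = {}" "A \<union> B = {0<..<1}"
  shows "gauss_mix {0<..<1} x = gauss_mix A x + gauss_mix B x"
proof -
  have "gauss_mix (A \<union> B) x = gauss_mix A x + gauss_mix B x"
    unfolding gauss_mix_def using assms
    by (intro set_integral_Un set_integrable_subset[OF integrable_gauss_mix_integrand]) auto
  then show ?thesis using assms(5) by simp
qed

text \<open>
  This controls the part of a superposition that is cut off near \<open>v = 0\<close>.
\<close>

lemma nn_integral_initial_segment_tendsto_0: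
  fixes w :: "real \<Rightarrow> real"
  assumes [measurable]: "w \<in> borel_measurable borel"
    and fin: "(\<integral>\<^sup>+ v. indicator {0<..<1} v * ennreal (w v) \<partial>lborel) < \<infinity>"
  shows "(\<lambda>n. \<integral>\<^sup>+ v. indicator {0<..1 / real (n + 2)} v * ennreal (w v) \<partial>lborel) \<longlonglongrightarrow> 0"
proof -
  have "(\<lambda>n. \<integral>\<^sup>+ v. indicator {0<..1 / real (n + 2)} v * ennreal (w v) \<partial>lborel)
      \<longlonglongrightarrow> (\<integral>\<^sup>+ v. 0 \<partial>(lborel :: real measure))"
  proof (rule nn_integral_dominated_convergence[where w = "\<lambda>v. indicator {0<..<1} v * ennreal (w v)"])
    show "AE v in lborel. indicator {0<..1 / real (n + 2)} v * ennreal (w v) \<le> indicator {0<..<1} v * ennreal (w v)" for n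
    proof (intro AE_I2 mult_right_mono)
      fix v :: real
      have mono: "indicator {0<..s} v \<le> (indicator {0<..<1} v :: ennreal)" if "s < 1" for s
        using that by (auto simp: indicator_def)
      show "indicator {0<..1 / real (n + 2)} v \<le> (indicator {0<..<1} v :: ennreal)"
        by (rule mono) simp
    qed simp
    show "AE v in lborel. (\<lambda>n. indicator {0<..1 / real (n + 2)} v * ennreal (w v)) \<longlonglongrightarrow> 0"
    proof (rule AE_I2, rule tendsto_eventually)
      fix v :: real
      show "\<forall>\<^sub>F n in sequentially. indicator {0<..1 / real (n + 2)} v * ennreal (w v) = 0"
      proof (cases "v > 0")
        case True
        then obtain N where N: "1 / real (Suc N) < v" using nat_approx_posE by blast
        have "indicator {0<..1 / real (n + 2)} v * ennreal (w v) = 0" if "n \<ge> N" for n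
        proof -
          have "1 / real (n + 2) \<le> 1 / real (Suc N)" using that by (intro divide_left_mono) auto
          then show ?thesis using N by (auto simp: indicator_def)
        qed
        then show ?thesis by (auto simp: eventually_sequentially)
      qed (auto simp: indicator_def)
    qed
  qed (use fin in auto)
  then show ?thesis by simp
qed

text \<open>
  Cutting off \<open>v\<close> near 0 leaves an integrable exact eigenfunction, because each \<open>gauss_diff v\<close> is itself one. Hence the
  distance of the transforms is \<open>(2 pi)^D\<close> times the distance of the functions, and only the convergence of the
  truncations to \<open>phi\<close> has to be shown.
\<close>

lemma fourier_L2_phi:
  assumes d: "DIM('a::euclidean_space) < 4"
  shows "fourier_L2 (\<lambda>x::'a. complex_of_real (phi x))
    (\<lambda>x. complex_of_real (- ((2 * pi) powr (real DIM('a) / 2)) * phi x))"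
proof -
  let ?D = "real DIM('a) / 2" and ?Q = "real DIM('a) / 4"
  let ?f = "\<lambda>x::'a. complex_of_real (phi x)"
  let ?g = "\<lambda>x::'a. complex_of_real (- ((2 * pi) powr ?D) * phi x)"
  define c where "c = 2 powr (1 - ?D)"
  define L where "L = (2 * pi) powr ?D"
  define w where "w v = (1 - v) powr (?D - 1) * v powr (- ?Q)" for v
  define K where "K = (16 + real DIM('a))\<^sup>2 * (4 * (2 * pi) powr ?D)"
  define I where "I S = (\<integral>\<^sup>+ v. indicator S v * ennreal (w v) \<partial>lborel)" for S
  have [measurable]: "w \<in> borel_measurable borel" unfolding w_def by measurable
  have I_fin: "I S < \<infinity>" if "S \<subseteq> {0<..<1}" for S
    unfolding I_def w_def using nn_integral_Beta_finite[of "1 - ?Q" ?D S] d that by auto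
  have sq_le: "(\<integral>\<^sup>+ x. ennreal ((c * gauss_mix S x)\<^sup>2) \<partial>(lborel :: 'a measure)) \<le> ennreal (c\<^sup>2 * K) * (I S)\<^sup>2"
    if S [measurable]: "S \<in> sets borel" and S01: "S \<subseteq> {0<..<1}" for S
  proof -
    have "(\<integral>\<^sup>+ x. ennreal ((c * gauss_mix S x)\<^sup>2) \<partial>(lborel :: 'a measure))
       = ennreal (c\<^sup>2) * (\<integral>\<^sup>+ x. ennreal ((gauss_mix S x)\<^sup>2) \<partial>(lborel :: 'a measure))"
      by (simp add: power_mult_distrib ennreal_mult' nn_integral_cmult)
    also have "\<dots> \<le> ennreal (c\<^sup>2) * (ennreal K * (I S)\<^sup>2)"
      using nn_integral_gauss_mix_square_le[OF S S01, where 'a='a]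
      unfolding I_def w_def K_def by (intro mult_left_mono) auto
    finally show ?thesis by (simp add: ennreal_mult' mult.assoc)
  qed
  have sq_int: "square_integrable (\<lambda>x::'a. complex_of_real (c * gauss_mix S x))"
    if S [measurable]: "S \<in> sets borel" and S01: "S \<subseteq> {0<..<1}" for S
    unfolding square_integrable_def
  proof
    have "ennreal (c\<^sup>2 * K) * (I S)\<^sup>2 < \<infinity>"
      using I_fin[OF S01] by (simp add: ennreal_mult_less_top power_less_top_ennreal)
    then have "(\<integral>\<^sup>+ x. ennreal ((c * gauss_mix S x)\<^sup>2) \<partial>(lborel :: 'a measure)) < \<infinity>"
      using sq_le[OF S S01] by (rule order_le_less_trans[rotated])
    then show "integrable lborel (\<lambda>x::'a. (cmod (complex_of_real (c * gauss_mix S x)))\<^sup>2)"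
      unfolding norm_of_real power2_abs by (intro integrableI_nonneg) auto
  qed measurable
  \<comment> \<open>Starting at 2 keeps the cut strictly inside the unit interval for every \<open>n\<close>.\<close>
  define S where "S n = {1 / real (n + 2)<..<1::real}" for n
  define S' where "S' n = {0<..1 / real (n + 2)}" for n
  have lt1: "1 / real (n + 2) < 1" "0 < 1 / real (n + 2)" for n by auto
  have S: "S n \<in> sets borel" "S n \<subseteq> {0<..<1}" "S' n \<in> sets borel" "S' n \<subseteq> {0<..<1}"
    "S n \<inter> S' n = {}" "S n \<union> S' n = {0<..<1}" for n
  proof -
    have "{s<..<1} \<subseteq> {0<..<1}" "{0<..s} \<subseteq> {0<..<1}" "{s<..<1} \<inter> {0<..s} = {}"
      "{s<..<1} \<union> {0<..s} = {0<..<1}" if "0 < s" "s < 1" for s :: real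
      using that by auto
    from this[OF lt1(2,1)[of n]]
    show "S n \<in> sets borel" "S n \<subseteq> {0<..<1}" "S' n \<in> sets borel" "S' n \<subseteq> {0<..<1}"
      "S n \<inter> S' n = {}" "S n \<union> S' n = {0<..<1}"
      by (simp_all only: S_def S'_def) simp_all
  qed
  define F where "F n x = complex_of_real (c * gauss_mix (S n) x)" for n and x :: 'a
  have F_fourier: "integrable lborel (F n)" "fourier (F n) t = - complex_of_real L * F n t" for n t
  proof -
    let ?s = "1 / real (n + 2)"
    have [measurable]: "S n \<in> sets borel" by (rule S)
    have "(\<integral>\<^sup>+ v. indicator (S n) v * ennreal ((1 - v) powr (?D - 1) * v powr (- ?D)) \<partial>lborel)
       \<le> (\<integral>\<^sup>+ v. ennreal (?s powr (- ?D)) * (indicator (S n) v * ennreal ((1 - v) powr (?D - 1) * v powr (1 - 1))) \<partial>lborel)"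
    proof (rule nn_integral_mono)
      fix v
      show "indicator (S n) v * ennreal ((1 - v) powr (?D - 1) * v powr (- ?D))
        \<le> ennreal (?s powr (- ?D)) * (indicator (S n) v * ennreal ((1 - v) powr (?D - 1) * v powr (1 - 1)))"
      proof (cases "v \<in> S n")
        case True
        then have v: "?s < v" "0 < v" using S(2)[of n] by (auto simp: S_def)
        then have "v powr (- ?D) \<le> ?s powr (- ?D)" using lt1[of n] by (intro powr_mono2') auto
        then have "(1 - v) powr (?D - 1) * v powr (- ?D) \<le> ?s powr (- ?D) * (1 - v) powr (?D - 1)"
          using mult_right_mono[OF _ powr_ge_zero, of "v powr (- ?D)" "?s powr (- ?D)" "1 - v" "?D - 1"]
          by (simp only: mult.commute)
        then show ?thesis using True v by (simp add: ennreal_mult'[symmetric] ennreal_leI)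
      qed simp
    qed
    also have "\<dots> = ennreal (?s powr (- ?D)) * (\<integral>\<^sup>+ v. indicator (S n) v * ennreal ((1 - v) powr (?D - 1) * v powr (1 - 1)) \<partial>lborel)"
      by (rule nn_integral_cmult) measurable
    also have "\<dots> < \<infinity>"
      using nn_integral_Beta_finite[of 1 ?D "S n"] S(2)[of n] by (auto simp: ennreal_mult_less_top)
    finally have fin: "(\<integral>\<^sup>+ v. indicator (S n) v * ennreal ((1 - v) powr (?D - 1) * v powr (- ?D)) \<partial>lborel) < \<infinity>" .
    note mix = fourier_gauss_mix[OF S(1,2) fin]
    have F_eq: "F n = (\<lambda>x. complex_of_real c * complex_of_real (gauss_mix (S n) x))"
      by (simp add: F_def fun_eq_iff)
    show "integrable lborel (F n)" unfolding F_eq using mix(1) by (rule integrable_mult_right)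
    show "fourier (F n) t = - complex_of_real L * F n t"
      unfolding F_eq fourier_cmult mix(2) by (simp add: L_def)
  qed
  have dist_le: "(\<integral>\<^sup>+ x. ennreal ((cmod (F n x - ?f x))\<^sup>2) \<partial>lborel) \<le> ennreal (c\<^sup>2 * K) * (I (S' n))\<^sup>2" for n
  proof -
    have "(\<integral>\<^sup>+ x. ennreal ((cmod (F n x - ?f x))\<^sup>2) \<partial>lborel)
       = (\<integral>\<^sup>+ x. ennreal ((c * gauss_mix (S' n) x)\<^sup>2) \<partial>(lborel :: 'a measure))"
    proof (rule nn_integral_cong_AE)
      show "AE x in lborel. ennreal ((cmod (F n x - ?f x))\<^sup>2) = ennreal ((c * gauss_mix (S' n) x)\<^sup>2)"
        using AE_lborel_singleton[of "0::'a"]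
      proof eventually_elim
        case (elim x)
        have "F n x - ?f x = complex_of_real (- (c * gauss_mix (S' n) x))"
          using gauss_mix_Un[OF elim S(1,3,5,6)[of n]] phi_eq_gauss_mix[OF elim]
          by (simp add: F_def c_def algebra_simps)
        then show ?case by (simp only: norm_of_real power2_abs power2_minus)
      qed
    qed
    also have "\<dots> \<le> ennreal (c\<^sup>2 * K) * (I (S' n))\<^sup>2" by (rule sq_le) (rule S)+
    finally show ?thesis .
  qed
  have lim: "(\<lambda>n. \<integral>\<^sup>+ x. ennreal ((cmod (F n x - ?f x))\<^sup>2) \<partial>lborel) \<longlonglongrightarrow> 0"
  proof (rule tendsto_sandwich[OF _ _ tendsto_const])
    have "(\<lambda>n. I (S' n)) \<longlonglongrightarrow> 0"
      unfolding I_def S'_def using I_fin[of "{0<..<1}"] unfolding I_def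
      by (intro nn_integral_initial_segment_tendsto_0) auto
    then have "(\<lambda>n. ennreal (c\<^sup>2 * K) * (I (S' n) * I (S' n))) \<longlonglongrightarrow> ennreal (c\<^sup>2 * K) * (0 * 0)"
      by (intro ennreal_tendsto_cmult tendsto_mult_ennreal) auto
    then show "(\<lambda>n. ennreal (c\<^sup>2 * K) * (I (S' n))\<^sup>2) \<longlonglongrightarrow> 0" by (simp add: power2_eq_square)
  qed (use dist_le in auto)
  have "(\<integral>\<^sup>+ t. ennreal ((cmod (fourier (F n) t - ?g t))\<^sup>2) \<partial>lborel)
      = ennreal (L\<^sup>2) * (\<integral>\<^sup>+ x. ennreal ((cmod (F n x - ?f x))\<^sup>2) \<partial>lborel)" for n
  proof -
    have "fourier (F n) t - ?g t = - complex_of_real L * (F n t - ?f t)" for t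
      unfolding F_fourier(2) by (simp add: L_def algebra_simps)
    then have "(cmod (fourier (F n) t - ?g t))\<^sup>2 = L\<^sup>2 * (cmod (F n t - ?f t))\<^sup>2" for t
      by (simp only: norm_mult norm_minus_cancel norm_of_real power_mult_distrib power2_abs)
    moreover have [measurable]: "F n \<in> borel_measurable borel"
      using F_fourier(1)[of n, THEN borel_measurable_integrable] by simp
    have "(\<lambda>x. ennreal ((cmod (F n x - ?f x))\<^sup>2)) \<in> borel_measurable lborel" by measurable
    ultimately show ?thesis
      by (simp only: ennreal_mult' zero_le_power2 nn_integral_cmult)
  qed
  moreover have "(\<lambda>n. ennreal (L\<^sup>2) * (\<integral>\<^sup>+ x. ennreal ((cmod (F n x - ?f x))\<^sup>2) \<partial>lborel)) \<longlonglongrightarrow> ennreal (L\<^sup>2) * 0"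
    by (intro ennreal_tendsto_cmult lim) auto
  ultimately have lim': "(\<lambda>n. \<integral>\<^sup>+ t. ennreal ((cmod (fourier (F n) t - ?g t))\<^sup>2) \<partial>lborel) \<longlonglongrightarrow> 0"
    by simp
  have f_sq: "square_integrable ?f"
  proof -
    have "AE x in lborel. (cmod (?f x))\<^sup>2 = (cmod (complex_of_real (c * gauss_mix {0<..<1} x)))\<^sup>2"
      using AE_phi_eq_gauss_mix by eventually_elim (simp add: c_def)
    then show ?thesis
      using sq_int[of "{0<..<1}"] unfolding square_integrable_def
      by (auto intro: integrable_cong_AE_imp)
  qed
  then have g_sq: "square_integrable ?g"
    unfolding square_integrable_def by (auto simp: norm_mult power_mult_distrib)
  have "integrable lborel (F n) \<and> square_integrable (F n)" for n
    using F_fourier(1)[of n] sq_int[OF S(1,2)[of n]] unfolding F_def by blast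
  with f_sq g_sq lim lim' show ?thesis unfolding fourier_L2_def by blast
qed

text \<open>
  The inner integral of the majorant against \<open>h\<close> is bounded uniformly in \<open>v\<close>, so that the weight
  \<open>(1 - v)^(D-1)\<close> alone decides convergence, and it is integrable in every dimension.
\<close>

lemma gauss_mix_pairing:
  fixes h :: "'a::euclidean_space \<Rightarrow> complex"
  assumes h: "integrable lborel h" and B: "\<And>x. cmod (h x) \<le> B"
  shows "integrable lborel (\<lambda>x. complex_of_real (gauss_mix {0<..<1} x) * h x)"
    and "(LINT x|lborel. complex_of_real (gauss_mix {0<..<1} x) * h x) =
      (LINT v|lborel. complex_of_real (indicator {0<..<1} v * (1 - v) powr (real DIM('a) / 2 - 2)) *
         (LINT x|lborel. complex_of_real (gauss_diff v x) * h x))"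
proof -
  let ?D = "real DIM('a) / 2"
  define M where "M = (LINT x|lborel. cmod (h x)) + B * (2 * pi) powr ?D"
  have [measurable]: "h \<in> borel_measurable borel" using h by (simp add: borel_measurable_integrable)
  have "(\<integral>\<^sup>+ v. indicator {0<..<1} v * ennreal ((1 - v) powr (?D - 1)) *
        (\<integral>\<^sup>+ x. ennreal (gauss_majorant v x * cmod (h x)) \<partial>lborel) \<partial>lborel)
     \<le> (\<integral>\<^sup>+ v. ennreal M * (indicator {0<..<1} v * ennreal ((1 - v) powr (?D - 1) * v powr (1 - 1))) \<partial>lborel)"
  proof (rule nn_integral_mono)
    fix v :: real
    show "indicator {0<..<1} v * ennreal ((1 - v) powr (?D - 1)) *
        (\<integral>\<^sup>+ x. ennreal (gauss_majorant v x * cmod (h x)) \<partial>lborel)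
      \<le> ennreal M * (indicator {0<..<1} v * ennreal ((1 - v) powr (?D - 1) * v powr (1 - 1)))"
    proof (cases "v \<in> {0<..<1}")
      case True
      then have "ennreal ((1 - v) powr (?D - 1)) * (\<integral>\<^sup>+ x. ennreal (gauss_majorant v x * cmod (h x)) \<partial>lborel)
         \<le> ennreal ((1 - v) powr (?D - 1)) * ennreal M"
        unfolding M_def by (intro mult_left_mono nn_integral_gauss_majorant_bounded_le h B) auto
      then show ?thesis using True by (simp add: mult.commute)
    qed simp
  qed
  also have "\<dots> = ennreal M * (\<integral>\<^sup>+ v. indicator {0<..<1} v * ennreal ((1 - v) powr (?D - 1) * v powr (1 - 1)) \<partial>lborel)"
    by (rule nn_integral_cmult) measurable
  also have "\<dots> < \<infinity>"
    using nn_integral_Beta_finite[of 1 ?D "{0<..<1}"] by (auto simp: ennreal_mult_less_top)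
  finally have fin: "(\<integral>\<^sup>+ v. indicator {0<..<1} v * ennreal ((1 - v) powr (?D - 1)) *
        (\<integral>\<^sup>+ x. ennreal (gauss_majorant v x * cmod (h x)) \<partial>lborel) \<partial>lborel) < \<infinity>" .
  show "integrable lborel (\<lambda>x. complex_of_real (gauss_mix {0<..<1} x) * h x)"
    and "(LINT x|lborel. complex_of_real (gauss_mix {0<..<1} x) * h x) =
      (LINT v|lborel. complex_of_real (indicator {0<..<1} v * (1 - v) powr (?D - 2)) *
         (LINT x|lborel. complex_of_real (gauss_diff v x) * h x))"
    using gauss_mix_Fubini[OF _ _ _ fin] by auto
qed

lemma fourier_tempered_phi:
  "fourier_tempered (\<lambda>x::'a::euclidean_space. complex_of_real (phi x))
    (\<lambda>x. complex_of_real (- ((2 * pi) powr (real DIM('a) / 2)) * phi x))"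
proof -
  let ?D = "real DIM('a) / 2"
  let ?f = "\<lambda>x::'a. complex_of_real (phi x)"
  let ?m = "\<lambda>x::'a. complex_of_real (gauss_mix {0<..<1} x)"
  define c where "c = complex_of_real (2 powr (1 - ?D))"
  define L where "L = complex_of_real ((2 * pi) powr ?D)"
  have g: "complex_of_real (- ((2 * pi) powr ?D) * phi x) = - L * ?f x" for x :: 'a
    by (simp add: L_def)
  have ae: "AE x in lborel. ?f x = c * ?m x"
    using AE_phi_eq_gauss_mix by eventually_elim (simp add: c_def)
  have pair: "(LINT x|lborel. ?f x * h x) = c * (LINT x|lborel. ?m x * h x)"
    if [measurable]: "h \<in> borel_measurable borel" for h
  proof -
    have "(LINT x|lborel. ?f x * h x) = (LINT x|lborel. c * (?m x * h x))"
    proof (rule integral_cong_AE)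
      show "AE x in lborel. ?f x * h x = c * (?m x * h x)"
        using ae by eventually_elim (simp add: mult.assoc)
    qed measurable
    then show ?thesis by simp
  qed
  have "tempered_function ?f"
  proof -
    have "integrable lborel (\<lambda>x. ?m x * complex_of_real (decay_weight x))"
    proof (rule gauss_mix_pairing(1))
      show "cmod (complex_of_real (decay_weight x)) \<le> 1" for x :: 'a
        using decay_weight_bounds[of x] by simp
    qed (simp add: integrable_decay_weight)
    then have int: "integrable lborel (\<lambda>x. c * (?m x * complex_of_real (decay_weight x)))"
      by (rule integrable_mult_right)
    have ae': "AE x in lborel. c * (?m x * complex_of_real (decay_weight x))
        = ?f x / complex_of_real (1 + norm x ^ (2 * DIM('a)))"
      using ae
    proof eventually_elim
      case (elim x)
      show ?case unfolding elim by (simp add: decay_weight_def)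
    qed
    show ?thesis
      unfolding tempered_function_def by (rule integrable_cong_AE_imp[OF int _ ae']) simp
  qed
  moreover from this have "tempered_function (\<lambda>x. - L * ?f x)"
    unfolding tempered_function_def times_divide_eq_right[symmetric] by (rule integrable_mult_right)
  moreover have "fourier_distribution (regular_distribution ?f) \<psi> = regular_distribution (\<lambda>x. - L * ?f x) \<psi>"
    if \<psi>: "\<psi> \<in> schwartz" for \<psi>
  proof -
    have Nil: "[] \<in> lists (Basis :: 'a set)" by simp
    have \<psi>_meas [measurable]: "\<psi> \<in> borel_measurable borel" using schwartz_measurable[OF \<psi> Nil] by simp
    have \<psi>_int: "integrable lborel \<psi>" using schwartz_integrable[OF \<psi> Nil] by simp
    have bounded: "\<exists>B. \<forall>x. cmod (h x) \<le> B" if "\<And>x. cmod (h x) \<le> C * decay_weight x" for h :: "'a \<Rightarrow> complex" and C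
    proof (intro exI allI)
      fix x :: 'a
      have "0 \<le> C * decay_weight x" using that[of x] norm_ge_zero order_trans by blast
      then have "0 \<le> C" using decay_weight_bounds(1)[of x] by (simp add: zero_le_mult_iff)
      then have "C * decay_weight x \<le> C" using decay_weight_bounds(2)[of x] by (simp add: mult_left_le)
      then show "cmod (h x) \<le> C" using that[of x] by linarith
    qed
    obtain B where B: "\<And>x. cmod (\<psi> x) \<le> B"
      using schwartz_decay[OF \<psi> Nil] bounded[of \<psi>] by (metis iter_partial.simps(1))
    obtain C where C: "\<And>t. cmod (fourier \<psi> t) \<le> C * decay_weight t" using fourier_schwartz_decay[OF \<psi>] by blast
    obtain B' where B': "\<And>t. cmod (fourier \<psi> t) \<le> B'" using bounded[OF C] by blast
    have F_meas: "fourier \<psi> \<in> borel_measurable borel" by (rule measurable_fourier) measurable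
    have F_int: "integrable lborel (fourier \<psi>)" by (rule integrable_le_decay_weight[OF F_meas C])
    let ?a = "\<lambda>v. complex_of_real (indicator {0<..<1} v * (1 - v) powr (?D - 2))"
    have "(LINT x|lborel. ?m x * fourier \<psi> x)
       = (LINT v|lborel. ?a v * (LINT x|lborel. complex_of_real (gauss_diff v x) * fourier \<psi> x))"
      by (rule gauss_mix_pairing(2)[OF F_int B'])
    also have "\<dots> = (LINT v|lborel. - L * (?a v * (LINT x|lborel. complex_of_real (gauss_diff v x) * \<psi> x)))"
    proof (rule Bochner_Integration.integral_cong[OF refl])
      fix v :: real
      show "?a v * (LINT x|lborel. complex_of_real (gauss_diff v x) * fourier \<psi> x)
        = - L * (?a v * (LINT x|lborel. complex_of_real (gauss_diff v x) * \<psi> x))"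
      proof (cases "v \<in> {0<..<1}")
        case True
        then have v: "v > 0" by simp
        have "(LINT x|lborel. complex_of_real (gauss_diff v x) * fourier \<psi> x)
            = (LINT t|lborel. fourier (\<lambda>x. complex_of_real (gauss_diff v x)) t * \<psi> t)"
          using integrable_gauss_diff[OF v, where 'a='a] \<psi>_int
          by (intro fourier_multiplication_formula) auto
        also have "\<dots> = - L * (LINT x|lborel. complex_of_real (gauss_diff v x) * \<psi> x)"
          unfolding fourier_gauss_diff[OF v] by (simp add: L_def mult.assoc)
        finally show ?thesis by (simp only: mult.left_commute)
      qed simp
    qed
    also have "\<dots> = - L * (LINT v|lborel. ?a v * (LINT x|lborel. complex_of_real (gauss_diff v x) * \<psi> x))"
      by (rule integral_mult_right_zero)
    also have "(LINT v|lborel. ?a v * (LINT x|lborel. complex_of_real (gauss_diff v x) * \<psi> x))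
       = (LINT x|lborel. ?m x * \<psi> x)"
      by (rule gauss_mix_pairing(2)[OF \<psi>_int B, symmetric])
    finally have "(LINT x|lborel. ?f x * fourier \<psi> x) = - L * (LINT x|lborel. ?f x * \<psi> x)"
      by (simp only: pair[OF F_meas] pair[OF \<psi>_meas] mult.left_commute)
    then show ?thesis
      by (simp only: fourier_distribution_def regular_distribution_def mult.assoc integral_mult_right_zero)
  qed
  ultimately show ?thesis unfolding fourier_tempered_def g by blast
qed

theorem theorem1:
  fixes f g :: "real ^ 'n \<Rightarrow> complex"
  defines "f \<equiv> (\<lambda>x. complex_of_real (phi x))"
    and "g \<equiv> (\<lambda>x. complex_of_real (- ((2 * pi) powr (real CARD('n) / 2)) * phi x))"
  shows "\<not> (AE x in lborel. f x = 0) \<and>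
    (CARD('n) = 1 \<longrightarrow> fourier_L1 f g) \<and>
    (CARD('n) = 2 \<or> CARD('n) = 3 \<longrightarrow> fourier_L2 f g) \<and>
    (CARD('n) \<ge> 4 \<longrightarrow> fourier_tempered f g)"
proof -
  have d: "DIM(real ^ 'n) = CARD('n)" by simp
  show ?thesis
    unfolding f_def g_def
    using phi_not_AE_zero[where 'a="real ^ 'n"] fourier_L1_phi[where 'a="real ^ 'n"]
      fourier_L2_phi[where 'a="real ^ 'n"] fourier_tempered_phi[where 'a="real ^ 'n"]
    unfolding d by auto
qed

end
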